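(* Let $\mathbf u$ be the random field on $\mathbb T^3$ obtained by randomizing the signs of the Fourier coefficients of an isotropic base field $\mathbf u_0$, as described in the context, and let $p\ge 3$. (i) Let $0<\ell<1$ be such that $\mathbf u_0$ is isotropic at scale $\ell$ and $\mathbb E\,\zeta_3(\ell)=1$. Then $$\frac p3+\frac{-\ln\sqrt\pi+p\ln2+\ln\Gamma((p+1)/2)}{\ln\ell}\;\le\;\mathbb E\,\zeta_p(\ell)\;\le\;p\Big(\frac13-\frac{2\ln2}{3\ln\ell}\Big),$$ where $\Gamma$ is the Euler Gamma function. (ii) If $\mathbf u_0$ is isotropic at scale $\ell$ and $\mathbb E\,\zeta_3(\ell)=1$ for all sufficiently small $\ell>0$, then $\lim_{\ell\to0}\mathbb E\,\zeta_p(\ell)=\frac p3$.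
   Context: Let $\mathbf u_0=\sum_{k\in\mathbb Z^3}u_ke^{ik\cdot x}$ be a vector field in $L^2(\mathbb T^3)$ with coefficients $u_k\in\mathbb C^3$, $u_{-k}=\overline{u_k}$, $u_0=0$. Isotropic at scale $\ell$ means: for each exponent $r>0$ (in particular $r=2$) the quantity $\frac{1}{|\mathbb T^3|}\int_{\mathbb T^3}|\mathbf u_0(x+\vec\ell)-\mathbf u_0(x)|^r\,dx$ takes the same value for all vectors $\vec\ell\in\mathbb R^3$ with $|\vec\ell|=\ell$. Let $\mathbb Z^3_+=\{n_1>0\}\cup\{n_1=0,n_2>0\}\cup\{n_1=n_2=0,n_3>0\}$, let $(\theta_k)_{k\in\mathbb Z^3_+}$ be independent random variables with $\theta_k=\pm1$ each with probability $1/2$, and set $\theta_{-k}=\theta_k$. The random field is $\mathbf u=\sum_{k\in\mathbb Z^3}u_k\theta_ke^{ik\cdot x}$. The structure function $\langle|\delta_\ell\mathbf u|^p\rangle$ is the average of $|\mathbf u(x+\vec\ell)-\mathbf u(x)|^p$ over $x\in\mathbb T^3$ (normalized Lebesgue measure) and over directions of $\vec\ell$ on the sphere $|\vec\ell|=\ell$ (normalized surface measure), and $\zeta_p=\zeta_p(\ell)=\log_\ell\langle|\delta_\ell\mathbf u|^p\rangle$ (a random variable). $\mathbb E$ denotes expectation over the $\theta_k$. It is assumed that $\mathbf u_0$ is nontrivial at the scales considered, i.e. $\langle|\delta_\ell\mathbf u_0|^2\rangle>0$. *)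

theory Defs
  imports "HOL-Probability.Probability"
begin

section \<open>Square-integrable fields on the three-dimensional torus\<close>

text \<open>
  Functions on the torus are functions on \<open>\<real>\<^sup>3\<close> that are \<open>2\<pi>\<close>-periodic in each coordinate.
  Field values lie in \<open>\<complex>\<^sup>3\<close>; coefficients with \<open>c (-k) = cnj (c k)\<close> give fields that are
  real-valued almost everywhere, and there the norm is the Euclidean norm of \<open>\<real>\<^sup>3\<close>.
\<close>

definition torus :: "(real^3) measure" where
  "torus = uniform_measure lborel (cbox 0 (\<chi> i. 2 * pi))"

definition torus_periodic :: "(real^3 \<Rightarrow> complex^3) \<Rightarrow> bool" where
  "torus_periodic f \<longleftrightarrow> (\<forall>(k::int^3) x. f (x + (\<chi> i. 2 * pi * of_int (k $ i))) = f x)"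

definition wave :: "int^3 \<Rightarrow> real^3 \<Rightarrow> complex" where
  "wave k x = exp (\<i> * of_real (\<Sum>i\<in>UNIV. of_int (k $ i) * x $ i))"

text \<open>
  \<open>f\<close> is a representative of the \<open>L\<^sup>2\<close> field with Fourier series \<open>\<Sum>\<^sub>k c k * exp (i k\<cdot>x)\<close>: the series
  converges to \<open>f\<close> in \<open>L\<^sup>2\<close>, unconditionally (along the finite sets of frequencies).
\<close>

definition L2_fourier_sum :: "(int^3 \<Rightarrow> complex^3) \<Rightarrow> (real^3 \<Rightarrow> complex^3) \<Rightarrow> bool" where
  "L2_fourier_sum c f \<longleftrightarrow>
     f \<in> borel_measurable borel \<and> torus_periodic f \<and>
     (\<integral>\<^sup>+x. ennreal (norm (f x) ^ 2) \<partial>torus) < \<infinity> \<and>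
     ((\<lambda>F. \<integral>\<^sup>+x. ennreal (norm (f x - (\<Sum>k\<in>F. wave k x *s c k)) ^ 2) \<partial>torus) \<longlongrightarrow> 0)
        (finite_subsets_at_top UNIV)"


section \<open>Structure functions\<close>

definition increment_moment :: "real \<Rightarrow> real^3 \<Rightarrow> (real^3 \<Rightarrow> complex^3) \<Rightarrow> ennreal" where
  "increment_moment r h f = (\<integral>\<^sup>+x. ennreal (norm (f (x + h) - f x) powr r) \<partial>torus)"

definition isotropic_at :: "real \<Rightarrow> (real^3 \<Rightarrow> complex^3) \<Rightarrow> bool" where
  "isotropic_at l f \<longleftrightarrow>
     (\<forall>r>0. \<forall>h h'. norm h = l \<longrightarrow> norm h' = l \<longrightarrow> increment_moment r h f = increment_moment r h' f)"

text \<open>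
  Normalized surface measure of the unit sphere, in spherical coordinates with polar angle \<open>a\<close> and
  azimuth \<open>b\<close>: the area element is \<open>sin a da db\<close> and the total area is \<open>4\<pi>\<close>.
\<close>

definition sphere_param :: "real \<times> real \<Rightarrow> real^3" where
  "sphere_param = (\<lambda>(a, b). vector [sin a * cos b, sin a * sin b, cos a])"

definition unit_sphere_measure :: "(real^3) measure" where
  "unit_sphere_measure =
     distr (density lborel
              (\<lambda>(a, b). ennreal (sin a / (4 * pi)) * indicator ({0..pi} \<times> {0..2 * pi}) (a, b)))
       borel sphere_param"

definition structure_function :: "real \<Rightarrow> real \<Rightarrow> (real^3 \<Rightarrow> complex^3) \<Rightarrow> ennreal" where
  "structure_function p l f = (\<integral>\<^sup>+s. increment_moment p (l *\<^sub>R s) f \<partial>unit_sphere_measure)"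

text \<open>
  The value is a convention when the structure function is \<open>0\<close> or \<open>\<infinity>\<close>. For the random fields
  below, at nontrivial scales where the base field is isotropic, this is a null event.
\<close>

definition zeta :: "real \<Rightarrow> real \<Rightarrow> (real^3 \<Rightarrow> complex^3) \<Rightarrow> real" where
  "zeta p l f = log l (enn2real (structure_function p l f))"


section \<open>Random signs\<close>

definition Z3_plus :: "(int^3) set" where
  "Z3_plus = {n. n $ 1 > 0} \<union> {n. n $ 1 = 0 \<and> n $ 2 > 0} \<union> {n. n $ 1 = 0 \<and> n $ 2 = 0 \<and> n $ 3 > 0}"

text \<open>\<open>\<theta> 0\<close> is unconstrained: it only ever multiplies a vanishing mean coefficient.\<close>

definition random_signs :: "'a measure \<Rightarrow> (int^3 \<Rightarrow> 'a \<Rightarrow> real) \<Rightarrow> bool" where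
  "random_signs M \<theta> \<longleftrightarrow>
     prob_space.indep_vars M (\<lambda>_. borel) \<theta> Z3_plus \<and>
     (\<forall>k\<in>Z3_plus. (\<forall>\<omega>\<in>space M. \<theta> k \<omega> \<in> {-1, 1}) \<and>
        measure M {\<omega> \<in> space M. \<theta> k \<omega> = 1} = 1 / 2 \<and>
        measure M {\<omega> \<in> space M. \<theta> k \<omega> = -1} = 1 / 2) \<and>
     (\<forall>k\<in>Z3_plus. \<forall>\<omega>\<in>space M. \<theta> (- k) \<omega> = \<theta> k \<omega>)"

end

theory Submission
  imports Defs
begin

text \<open>
  Write \<open>S\<^sub>q(\<omega>)\<close> for the structure function of order \<open>q\<close> at scale \<open>l\<close> of the field \<open>u \<omega>\<close>. Changing
  signs of Fourier coefficients does not change the \<open>L\<^sup>2\<close> norm of an increment (\<open>parseval\<close>), and by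
  isotropy this norm is the same in all directions; so \<open>S\<^sub>2(\<omega>) = A\<close> is a deterministic number.
  
  \<^bold>\<open>Upper bound for the exponent.\<close> Torus and sphere carry probability measures, so power means increase:
  \<open>S\<^sub>3 powr (p/3) \<le> S\<^sub>p\<close>. Dividing logarithms by \<open>ln l < 0\<close> gives \<open>\<zeta>\<^sub>p \<le> p/3 * \<zeta>\<^sub>3\<close>, hence
  \<open>E \<zeta>\<^sub>p \<le> p/3\<close>, which is stronger than the bound claimed since \<open>ln 2 / ln l < 0\<close>.
  
  \<^bold>\<open>Lower bound.\<close> By Jensen \<open>E ln S\<^sub>p \<le> ln E S\<^sub>p\<close>. At a fixed point and direction the increment is a
  Rademacher sum of vectors \<open>d\<^sub>k + d\<^sub>-\<^sub>k\<close>, one for each pair of opposite frequencies. The sum of their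
  squared norms is at most \<open>2 A\<close>, so Khintchine's inequality bounds \<open>E S\<^sub>p\<close> by \<open>K (2 A) powr (p/2)\<close>.
  Since \<open>S\<^sub>3 \<ge> A powr (3/2)\<close> and \<open>E ln S\<^sub>3 = ln l\<close>, also \<open>A powr (p/2) \<le> l powr (p/3)\<close>. The
  claimed inequality comes out exactly when \<open>K\<close> is the \<open>p\<close>-th absolute moment of a standard Gaussian.
  
  \<^bold>\<open>Khintchine with the Gaussian constant\<close> is where \<open>p \<ge> 3\<close> enters: then the second derivative of
  \<open>\<bar>x\<bar> powr p\<close> is convex, so \<open>\<bar>x + t\<bar> powr p + \<bar>x - t\<bar> powr p\<close> lies above its tangent as a function of
  \<open>t\<^sup>2\<close> (\<open>powr_second_difference\<close>). Averaging over a Gaussian \<open>t\<close> of variance \<open>a\<^sup>2\<close> shows that a random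
  sign \<open>\<plusminus>a\<close> may be replaced by that Gaussian (\<open>gauss_moment_two_point\<close>); doing this for one sign after
  the other leaves a single Gaussian (\<open>khintchine_gauss\<close>). The vector case follows coordinatewise by
  convexity (\<open>khintchine_euclidean\<close>).
  
  \<^bold>\<open>Infinite sums.\<close> The fields are only \<open>L\<^sup>2\<close> limits, given by an arbitrary representative for each
  \<open>\<omega>\<close>. The truncation error has the same \<open>L\<^sup>2\<close> norm for all \<open>\<omega>\<close>, so one sequence of finite frequency sets
  makes the truncated fields converge almost everywhere on the torus for every \<open>\<omega>\<close>
  (\<open>partial_field_LIMSEQ\<close>). This gives measurability of \<open>S\<^sub>p\<close> in \<open>\<omega>\<close>, and Fatou's lemma carries the
  Khintchine bound over to the limit (\<open>nn_integral_structure_function_le\<close>).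
\<close>

section \<open>Second differences of absolute powers\<close>

lemma convex_on_powr_nonneg:
  fixes q :: real
  assumes "q \<ge> 1"
  shows "convex_on {0..} (\<lambda>x. x powr q)"
proof (rule convex_onI)
  fix t x y :: real
  assume t: "0 < t" "t < 1" and xy: "x \<in> {0..}" "y \<in> {0..}"
  show "((1 - t) *\<^sub>R x + t *\<^sub>R y) powr q \<le> (1 - t) * x powr q + t * y powr q"
  proof (cases "x = 0 \<or> y = 0")
    case False
    then show ?thesis
      using convex_onD[OF powr_convex[OF assms], of t x y] t xy by auto
  next
    case True
    have le: "s powr q \<le> s" if "0 < s" "s < 1" for s :: real
      using powr_mono'[of 1 q s] assms that by simp
    from True show ?thesis
      using le[of t] le[of "1 - t"] t xy
      by (auto simp: powr_mult intro!: mult_right_mono)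
  qed
qed simp

text \<open>
  The points \<open>x \<plusminus> s\<close> are convex combinations of \<open>x \<plusminus> t\<close> with opposite weights, so this is convexity
  used twice.
\<close>

lemma powr_abs_add_mono:
  fixes q x s t :: real
  assumes q: "q \<ge> 1" and st: "0 \<le> s" "s \<le> t"
  shows "\<bar>x + s\<bar> powr q + \<bar>x - s\<bar> powr q \<le> \<bar>x + t\<bar> powr q + \<bar>x - t\<bar> powr q"
proof (cases "t = 0")
  case True
  with st show ?thesis by simp
next
  case False
  with st have t: "t > 0" by simp
  define v where "v = (t - s) / (2 * t)"
  have v: "0 \<le> v" "v \<le> 1" using t st by (auto simp: v_def field_simps)
  have key: "\<bar>(1 - w) * a + w * b\<bar> powr q \<le> (1 - w) * \<bar>a\<bar> powr q + w * \<bar>b\<bar> powr q"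
    if "0 \<le> w" "w \<le> 1" for w a b :: real
  proof -
    have "\<bar>(1 - w) * a + w * b\<bar> \<le> (1 - w) * \<bar>a\<bar> + w * \<bar>b\<bar>"
      using that by (intro order_trans[OF abs_triangle_ineq]) (simp add: abs_mult)
    then have "\<bar>(1 - w) * a + w * b\<bar> powr q \<le> ((1 - w) * \<bar>a\<bar> + w * \<bar>b\<bar>) powr q"
      using q by (intro powr_mono2) auto
    also have "\<dots> \<le> (1 - w) * \<bar>a\<bar> powr q + w * \<bar>b\<bar> powr q"
      using convex_onD[OF convex_on_powr_nonneg[OF q], of w "\<bar>a\<bar>" "\<bar>b\<bar>"] that by simp
    finally show ?thesis .
  qed
  have eq: "(1 - v) * (x + t) + v * (x - t) = x + s" "(1 - v) * (x - t) + v * (x + t) = x - s"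
    using t by (simp_all add: v_def field_simps)
  have "(1 - v) * P + v * Q + ((1 - v) * Q + v * P) = P + Q" for P Q :: real
    by (simp add: algebra_simps)
  then show ?thesis
    using add_mono[OF key[OF v, of "x + t" "x - t"] key[OF v, of "x - t" "x + t"]]
    by (simp only: eq)
qed

lemma has_real_derivative_abs_powr:
  fixes q y :: real
  assumes q: "q > 1"
  shows "((\<lambda>y. \<bar>y\<bar> powr q) has_real_derivative q * sgn y * \<bar>y\<bar> powr (q - 1)) (at y)"
    and "((\<lambda>y. sgn y * \<bar>y\<bar> powr q) has_real_derivative q * \<bar>y\<bar> powr (q - 1)) (at y)"
proof -
  have lim: "((\<lambda>y. \<bar>y\<bar> powr (q - 1)) \<longlongrightarrow> 0) (at (0::real))"
    using q by (auto intro!: tendsto_eq_intros)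
  have pw: "\<bar>y\<bar> powr q = \<bar>y\<bar> powr (q - 1) * \<bar>y\<bar>" for y :: real
    by (cases "y = 0") (simp_all add: powr_diff)
  show "((\<lambda>y. \<bar>y\<bar> powr q) has_real_derivative q * sgn y * \<bar>y\<bar> powr (q - 1)) (at y)"
  proof (cases "y = 0")
    case False
    have "((\<lambda>y. (sgn y0 * y) powr q) has_real_derivative q * (sgn y0 * y0) powr (q - 1) * sgn y0) (at y0)"
      if "y0 \<noteq> 0" for y0 :: real
      using that q by (auto intro!: derivative_eq_intros simp: sgn_if)
    from this[OF False] have *: "((\<lambda>z. (sgn y * z) powr q) has_real_derivative q * sgn y * \<bar>y\<bar> powr (q - 1)) (at y)"
      by (simp add: mult_ac abs_sgn)
    show ?thesis
      by (rule has_field_derivative_transform_within_open[OF *, of "{z. sgn y * z > 0}"])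
         (use False in \<open>auto simp: sgn_if abs_if intro!: open_Collect_less continuous_intros\<close>)
  next
    case True
    have "((\<lambda>h. (\<bar>h\<bar> powr q) / h) \<longlongrightarrow> 0) (at 0)"
      by (rule Lim_null_comparison[OF _ lim]) (auto simp: pw intro!: always_eventually)
    then show ?thesis using True q by (simp add: DERIV_def)
  qed
  show "((\<lambda>y. sgn y * \<bar>y\<bar> powr q) has_real_derivative q * \<bar>y\<bar> powr (q - 1)) (at y)"
  proof (cases "y = 0")
    case False
    have "((\<lambda>z. sgn y * (sgn y * z) powr q) has_real_derivative sgn y * (q * (sgn y * y) powr (q - 1) * sgn y)) (at y)"
      using False q by (auto intro!: derivative_eq_intros simp: sgn_if)
    then have *: "((\<lambda>z. sgn y * (sgn y * z) powr q) has_real_derivative q * \<bar>y\<bar> powr (q - 1)) (at y)"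
      using False by (simp add: mult_ac abs_sgn sgn_if split: if_splits)
    show ?thesis
      by (rule has_field_derivative_transform_within_open[OF *, of "{z. sgn y * z > 0}"])
         (use False in \<open>auto simp: sgn_if abs_if intro!: open_Collect_less continuous_intros split: if_splits\<close>)
  next
    case True
    have "((\<lambda>h. (sgn h * \<bar>h\<bar> powr q) / h) \<longlongrightarrow> 0) (at 0)"
      by (rule Lim_null_comparison[OF _ lim]) (auto simp: pw abs_mult abs_sgn_eq intro!: always_eventually)
    then show ?thesis using True q by (simp add: DERIV_def)
  qed
qed

text \<open>
  Let \<open>D t\<close> be the \<open>t\<close>-derivative of \<open>\<bar>x + t\<bar> powr p + \<bar>x - t\<bar> powr p\<close>. Its own derivative is increasing for
  \<open>t \<ge> 0\<close> because \<open>p - 2 \<ge> 1\<close>; as \<open>D 0 = 0\<close>, the quotient \<open>D t / t\<close> is increasing as well. In other words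
  the expression is a convex function of \<open>t\<^sup>2\<close>, and \<open>\<kappa>\<close> is its slope there at \<open>t\<^sup>2 = a\<^sup>2\<close>. The
  \<open>\<kappa>\<close>-terms are placed so that all terms are nonnegative and the inequality can be integrated in \<open>ennreal\<close>.
\<close>

lemma powr_second_difference:
  fixes p x a :: real
  assumes p: "p \<ge> 3" and a: "a > 0"
  obtains \<kappa> where "\<kappa> \<ge> 0"
    "\<And>t. \<bar>x + a\<bar> powr p + \<bar>x - a\<bar> powr p + \<kappa> * t\<^sup>2 \<le> \<bar>x + t\<bar> powr p + \<bar>x - t\<bar> powr p + \<kappa> * a\<^sup>2"
proof -
  define g where "g y = p * (sgn y * \<bar>y\<bar> powr (p - 1))" for y :: real
  define D where "D t = g (x + t) - g (x - t)" for t
  define E where "E t = p * ((p - 1) * \<bar>x + t\<bar> powr (p - 2)) + p * ((p - 1) * \<bar>x - t\<bar> powr (p - 2))" for t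
  have E_mono: "E s \<le> E t" if "0 \<le> s" "s \<le> t" for s t
    using powr_abs_add_mono[of "p - 2" s t x] p that
    by (auto simp: E_def distrib_left[symmetric] mult.assoc[symmetric] intro!: mult_left_mono)
  have E_nonneg: "E t \<ge> 0" for t
    using p by (auto simp: E_def intro!: add_nonneg_nonneg mult_nonneg_nonneg)
  have f_deriv: "((\<lambda>y. \<bar>y\<bar> powr p) has_real_derivative g y) (at y)" for y
    using has_real_derivative_abs_powr(1)[of p y] p by (simp add: g_def mult.assoc)
  have g_deriv: "(g has_real_derivative p * ((p - 1) * \<bar>y\<bar> powr (p - 2))) (at y)" for y
    unfolding g_def using DERIV_cmult[OF has_real_derivative_abs_powr(2)[of "p - 1" y], of p] p by simp
  have D_deriv: "(D has_real_derivative E t) (at t)" for t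
    unfolding D_def E_def
    by (rule derivative_eq_intros DERIV_chain2[OF g_deriv] refl | simp)+
  have D0: "D 0 = 0" by (simp add: D_def)
  \<comment> \<open>Monotonicity of \<open>D t / t\<close>, by the mean value theorem on \<open>[0, t]\<close> and on \<open>[t, s]\<close>.\<close>
  have slope: "s * D t \<le> t * D s" if st: "0 \<le> t" "t \<le> s" for s t
  proof (cases "t = 0 \<or> t = s")
    case True
    then show ?thesis using D0 by auto
  next
    case False
    then have st': "0 < t" "t < s" using st by auto
    obtain \<xi> where \<xi>: "0 < \<xi>" "\<xi> < t" "D t - D 0 = (t - 0) * E \<xi>"
      using MVT2[OF st'(1), of D E] D_deriv by blast
    obtain \<eta> where \<eta>: "t < \<eta>" "\<eta> < s" "D s - D t = (s - t) * E \<eta>"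
      using MVT2[OF st'(2), of D E] D_deriv by blast
    have "s * D t = t * D t + t * ((s - t) * E \<xi>)" using \<xi> D0 by (simp add: algebra_simps)
    also have "\<dots> \<le> t * D t + t * ((s - t) * E \<eta>)"
      using E_mono[of \<xi> \<eta>] \<xi> \<eta> st' by (intro add_left_mono mult_left_mono) auto
    also have "\<dots> = t * (D t + (s - t) * E \<eta>)" by (simp only: distrib_left)
    also have "D t + (s - t) * E \<eta> = D s" using \<eta>(3) by simp
    finally show ?thesis .
  qed
  define \<kappa> where "\<kappa> = D a / (2 * a)"
  have "D a \<ge> 0"
  proof -
    obtain \<xi> where "D a - D 0 = (a - 0) * E \<xi>"
      using MVT2[OF a, of D E] D_deriv by blast
    then show ?thesis using D0 E_nonneg[of \<xi>] a by simp
  qed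
  then have \<kappa>: "\<kappa> \<ge> 0" using a by (simp add: \<kappa>_def)
  \<comment> \<open>\<open>\<kappa>\<close> makes \<open>a\<close> a critical point of \<open>\<psi>\<close>; by \<open>slope\<close> it is the minimum.\<close>
  define \<psi> where "\<psi> t = \<bar>x + t\<bar> powr p + \<bar>x - t\<bar> powr p - \<kappa> * t\<^sup>2" for t
  have \<psi>_deriv: "(\<psi> has_real_derivative D t - D a * t / a) (at t)" for t
    unfolding \<psi>_def D_def \<kappa>_def
    by (rule derivative_eq_intros DERIV_chain2[OF f_deriv] refl | simp)+
  have pos: "\<psi> a \<le> \<psi> t" if t: "t \<ge> 0" for t
  proof (cases "t \<le> a")
    case True
    show ?thesis
    proof (rule DERIV_nonpos_imp_nonincreasing[OF True])
      fix z assume z: "t \<le> z" "z \<le> a"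
      have "D z - D a * z / a \<le> 0"
        using slope[of z a] z t a by (simp add: field_simps)
      then show "\<exists>y. DERIV \<psi> z :> y \<and> y \<le> 0" using \<psi>_deriv by blast
    qed
  next
    case False
    then have at: "a \<le> t" by simp
    show ?thesis
    proof (rule DERIV_nonneg_imp_nondecreasing[OF at])
      fix z assume z: "a \<le> z" "z \<le> t"
      have "D z - D a * z / a \<ge> 0"
        using slope[of a z] z t a by (simp add: field_simps)
      then show "\<exists>y. DERIV \<psi> z :> y \<and> y \<ge> 0" using \<psi>_deriv by blast
    qed
  qed
  have all: "\<psi> a \<le> \<psi> t" for t
    using pos[of t] pos[of "- t"] by (cases "t \<ge> 0") (simp_all add: \<psi>_def)
  show thesis
    by (rule that[OF \<kappa>]) (use all in \<open>simp add: \<psi>_def algebra_simps\<close>)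
qed

section \<open>Gaussian moments\<close>

text \<open>
  The substitution \<open>z = sqrt (2 t)\<close> turns half of the integral into the Gamma integral.
\<close>

lemma std_normal_absolute_moment:
  fixes p :: real
  assumes p: "p > 0"
  shows "(\<integral>\<^sup>+z. ennreal (std_normal_density z * \<bar>z\<bar> powr p) \<partial>lborel)
           = ennreal (2 powr (p / 2) * Gamma ((p + 1) / 2) / sqrt pi)"
proof -
  define s where "s = (p + 1) / 2"
  have s: "s > 0" using p by (simp add: s_def)
  define f where "f z = z powr p * exp (- z\<^sup>2 / 2)" for z :: real
  define C where "C = 2 powr ((p - 1) / 2)"
  have C: "C > 0" by (simp add: C_def)
  have fg: "f (sqrt (2 * t)) * (1 / sqrt (2 * t)) = C * (t powr (s - 1) / exp t)" if "t > 0" for t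
  proof -
    have "sqrt (2 * t) powr p = (2 * t) powr (p / 2)"
      using that by (simp add: powr_half_sqrt[symmetric] powr_powr)
    moreover have "(sqrt (2 * t))\<^sup>2 = 2 * t" using that by simp
    ultimately have "f (sqrt (2 * t)) * (1 / sqrt (2 * t)) = (2 * t) powr (p / 2 - 1 / 2) * exp (- t)"
      using that by (simp only: f_def powr_diff) (simp add: powr_half_sqrt)
    also have "p / 2 - 1 / 2 = (p - 1) / 2" by (simp add: field_simps)
    also have "(2 * t) powr ((p - 1) / 2) = C * t powr (s - 1)"
      using that by (simp add: powr_mult C_def s_def field_simps)
    finally show ?thesis by (simp add: exp_minus field_simps)
  qed
  have int0: "set_integrable lborel {0<..} (\<lambda>t. t powr (s - 1) / exp t)"
    and val0: "(LBINT t:{0<..}. t powr (s - 1) / exp t) = Gamma s"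
  proof -
    have eq: "ennreal (Gamma s) = (\<integral>\<^sup>+t. ennreal (indicator {0<..} t *\<^sub>R (t powr (s - 1) / exp t)) \<partial>lborel)"
      unfolding Gamma_conv_nn_integral_real[OF s]
      by (intro nn_integral_cong_AE eventually_mono[OF AE_lborel_singleton[of 0]])
         (auto simp: indicator_def)
    have "has_bochner_integral lborel (\<lambda>t. indicator {0<..} t *\<^sub>R (t powr (s - 1) / exp t)) (Gamma s)"
      by (rule has_bochner_integral_nn_integral) (use eq s in \<open>auto simp: Gamma_real_pos less_imp_le\<close>)
    then show "set_integrable lborel {0<..} (\<lambda>t. t powr (s - 1) / exp t)"
      and "(LBINT t:{0<..}. t powr (s - 1) / exp t) = Gamma s"
      by (auto simp: set_integrable_def set_lebesgue_integral_def has_bochner_integral_iff)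
  qed
  have ei: "einterval 0 \<infinity> = {0::real<..}" by (auto simp: einterval_def zero_ereal_def)
  have int1: "set_integrable lborel (einterval 0 \<infinity>) (\<lambda>t. f (sqrt (2 * t)) * (1 / sqrt (2 * t)))"
    unfolding ei using set_integrable_mult_right[OF int0, of C]
    by (subst set_integrable_cong[OF refl refl fg]) auto
  have deriv: "DERIV (\<lambda>t. sqrt (2 * t)) t :> 1 / sqrt (2 * t)" if "t > 0" for t
    using that by (auto intro!: derivative_eq_intros simp: field_simps)
  have contf: "isCont f z" if "z > 0" for z
    using that unfolding f_def by (intro continuous_intros) auto
  have contg: "isCont (\<lambda>t. 1 / sqrt (2 * t)) t" if "t > 0" for t
    using that by (intro continuous_intros) auto
  note sub = interval_integral_substitution_nonneg[of 0 \<infinity> "\<lambda>t. sqrt (2 * t)" "\<lambda>t. 1 / sqrt (2 * t)" f 0 \<infinity>]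
  have A: "set_integrable lborel (einterval 0 \<infinity>) f"
    "(LBINT x=0..\<infinity>. f x) = (LBINT x=0..\<infinity>. f (sqrt (2 * x)) * (1 / sqrt (2 * x)))"
    apply (rule_tac [!] sub)
    using deriv int1
    apply (auto simp: f_def[of "sqrt _"] zero_ereal_def ereal_tendsto_simps ei
        intro!: contf contg tendsto_eq_intros filterlim_compose[OF sqrt_at_top] filterlim_tendsto_pos_mult_at_top[of _ 2] filterlim_ident)
    done
  have val: "(LBINT x:{0<..}. f x) = C * Gamma s"
  proof -
    have "(LBINT x:{0<..}. f x) = (LBINT t:{0<..}. f (sqrt (2 * t)) * (1 / sqrt (2 * t)))"
      using A(2) unfolding interval_lebesgue_integral_def ei by simp
    also have "\<dots> = (LBINT t:{0<..}. C * (t powr (s - 1) / exp t))"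
      by (rule set_lebesgue_integral_cong) (use fg in auto)
    finally show ?thesis by (simp only: set_integral_mult_right val0)
  qed
  have "(\<integral>\<^sup>+z. ennreal (std_normal_density z * \<bar>z\<bar> powr p) \<partial>lborel)
      = (\<integral>\<^sup>+z. ennreal (std_normal_density z * \<bar>z\<bar> powr p) * indicator {0<..} z
           + ennreal (std_normal_density z * \<bar>z\<bar> powr p) * indicator {..<0} z \<partial>lborel)"
    by (intro nn_integral_cong_AE eventually_mono[OF AE_lborel_singleton[of 0]])
       (auto simp: indicator_def)
  also have "\<dots> = (\<integral>\<^sup>+z. ennreal (std_normal_density z * \<bar>z\<bar> powr p) * indicator {0<..} z \<partial>lborel)
           + (\<integral>\<^sup>+z. ennreal (std_normal_density z * \<bar>z\<bar> powr p) * indicator {..<0} z \<partial>lborel)"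
    by (rule nn_integral_add) auto
  also have "(\<integral>\<^sup>+z. ennreal (std_normal_density z * \<bar>z\<bar> powr p) * indicator {..<0} z \<partial>lborel)
           = (\<integral>\<^sup>+z. ennreal (std_normal_density z * \<bar>z\<bar> powr p) * indicator {0<..} z \<partial>lborel)"
    by (subst nn_integral_real_affine[of _ "-1" 0])
       (auto simp: std_normal_density_def indicator_def intro!: nn_integral_cong)
  also have "(\<integral>\<^sup>+z. ennreal (std_normal_density z * \<bar>z\<bar> powr p) * indicator {0<..} z \<partial>lborel)
      = (\<integral>\<^sup>+z. ennreal (1 / sqrt (2 * pi)) * ennreal (indicator {0<..} z *\<^sub>R f z) \<partial>lborel)"
    by (intro nn_integral_cong)
       (auto simp: indicator_def std_normal_density_def f_def ennreal_mult'[symmetric] mult_ac)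
  also have "\<dots> = ennreal (1 / sqrt (2 * pi)) * (\<integral>\<^sup>+z. ennreal (indicator {0<..} z *\<^sub>R f z) \<partial>lborel)"
    by (rule nn_integral_cmult) (auto simp: f_def)
  also have "(\<integral>\<^sup>+z. ennreal (indicator {0<..} z *\<^sub>R f z) \<partial>lborel) = ennreal (C * Gamma s)"
    using A(1) val unfolding ei set_integrable_def set_lebesgue_integral_def
    by (subst nn_integral_eq_integral) (auto simp: f_def indicator_def)
  also have "ennreal (1 / sqrt (2 * pi)) * ennreal (C * Gamma s) + ennreal (1 / sqrt (2 * pi)) * ennreal (C * Gamma s)
      = ennreal (2 * (1 / sqrt (2 * pi)) * (C * Gamma s))"
    using C s by (simp add: ennreal_mult'[symmetric] ennreal_plus[symmetric] Gamma_real_pos less_imp_le del: ennreal_plus)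
  also have "2 * (1 / sqrt (2 * pi)) * (C * Gamma s) = 2 powr (p / 2) * Gamma s / sqrt pi"
  proof -
    have "C = 2 powr (p / 2 - 1 / 2)" by (simp add: C_def diff_divide_distrib)
    then have C_eq: "2 powr (p / 2) = sqrt 2 * C" by (simp add: powr_diff powr_half_sqrt)
    have "2 * (1 / sqrt (2 * pi)) * (C * Gamma s) = (2 / sqrt 2) * C * Gamma s / sqrt pi"
      by (simp add: real_sqrt_mult)
    then show ?thesis by (simp add: C_eq real_div_sqrt)
  qed
  finally show ?thesis by (simp add: s_def)
qed

text \<open>
  This is \<open>E \<bar>x + s Z\<bar> powr p\<close> for a standard Gaussian \<open>Z\<close>, that is, the heat semigroup applied to
  \<open>\<bar>x\<bar> powr p\<close>. Scaling \<open>Z\<close> instead of using a density of variance \<open>s\<^sup>2\<close> keeps the degenerate case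
  \<open>s = 0\<close>, from which the induction in \<open>khintchine_gauss\<close> starts.
\<close>

definition gauss_moment :: "real \<Rightarrow> real \<Rightarrow> real \<Rightarrow> ennreal" where
  "gauss_moment p s x = (\<integral>\<^sup>+z. ennreal (std_normal_density z) * ennreal (\<bar>x + s * z\<bar> powr p) \<partial>lborel)"

lemma nn_integral_std_normal: "(\<integral>\<^sup>+z. ennreal (std_normal_density z) \<partial>lborel) = 1"
  by (subst nn_integral_eq_integral) auto

lemma measurable_gauss_moment [measurable]: "gauss_moment p s \<in> borel_measurable borel"
  unfolding gauss_moment_def by measurable

lemma gauss_moment_0: "gauss_moment p 0 x = ennreal (\<bar>x\<bar> powr p)"
  by (simp add: gauss_moment_def nn_integral_multc nn_integral_std_normal)

lemma gauss_moment_centred: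
  assumes "p > 0" "s \<ge> 0"
  shows "gauss_moment p s 0 = ennreal (2 powr (p / 2) * Gamma ((p + 1) / 2) / sqrt pi * s powr p)"
proof -
  have "gauss_moment p s 0 = (\<integral>\<^sup>+z. ennreal (std_normal_density z * \<bar>z\<bar> powr p) * ennreal (s powr p) \<partial>lborel)"
    unfolding gauss_moment_def using assms
    by (intro nn_integral_cong) (simp add: abs_mult powr_mult ennreal_mult'[symmetric] mult_ac)
  also have "\<dots> = ennreal (2 powr (p / 2) * Gamma ((p + 1) / 2) / sqrt pi) * ennreal (s powr p)"
    using assms by (subst nn_integral_multc) (auto simp: std_normal_absolute_moment)
  finally show ?thesis by (simp only: ennreal_mult''[OF powr_ge_zero])
qed

lemma nn_integral_std_normal_scale:
  assumes s: "s > 0" and [measurable]: "F \<in> borel_measurable borel"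
  shows "(\<integral>\<^sup>+z. ennreal (std_normal_density z) * F (s * z) \<partial>lborel)
           = (\<integral>\<^sup>+y. ennreal (normal_density 0 s y) * F y \<partial>lborel)"
proof -
  have "s * normal_density 0 s (s * z) = std_normal_density z" for z
    using s by (simp add: normal_density_def real_sqrt_mult power_mult_distrib field_simps)
  then have "ennreal s * (ennreal (normal_density 0 s (s * z)) * F (s * z)) = ennreal (std_normal_density z) * F (s * z)" for z
    using s by (simp add: ennreal_mult'[symmetric] flip: mult.assoc)
  then show ?thesis
    using s by (subst (2) nn_integral_real_affine[of _ s 0]) (auto simp: nn_integral_cmult[symmetric])
qed

text \<open>
  The semigroup law: independent centred Gaussians add, and so do their variances.
\<close>

lemma gauss_moment_convolution:
  assumes "s \<ge> 0" and "a \<ge> 0"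
  shows "(\<integral>\<^sup>+z. ennreal (std_normal_density z) * gauss_moment p a (x + s * z) \<partial>lborel)
           = gauss_moment p (sqrt (s\<^sup>2 + a\<^sup>2)) x"
proof (cases "s = 0 \<or> a = 0")
  case True
  then show ?thesis
    using assms
    by (auto simp: gauss_moment_0 nn_integral_multc nn_integral_std_normal gauss_moment_def[of p s x])
next
  case False
  with assms have s: "s > 0" and a: "a > 0" by auto
  define F where "F y = ennreal (\<bar>x + y\<bar> powr p)" for y
  have [measurable]: "F \<in> borel_measurable borel" by (simp add: F_def[abs_def])
  define n where "n t y = ennreal (normal_density 0 t y)" for t y
  have [measurable]: "n t \<in> borel_measurable borel" for t by (simp add: n_def[abs_def])
  have gm: "gauss_moment p t (x + b) = (\<integral>\<^sup>+y. n t y * F (b + y) \<partial>lborel)" if "t > 0" for t b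
    using nn_integral_std_normal_scale[OF that, of "\<lambda>y. F (b + y)"]
    by (simp add: gauss_moment_def n_def F_def add.assoc)
  have "(\<integral>\<^sup>+z. ennreal (std_normal_density z) * gauss_moment p a (x + s * z) \<partial>lborel)
      = (\<integral>\<^sup>+v. n s v * (\<integral>\<^sup>+y. n a y * F (v + y) \<partial>lborel) \<partial>lborel)"
    using nn_integral_std_normal_scale[OF s, of "\<lambda>b. gauss_moment p a (x + b)"]
    by (simp add: gm[OF a] n_def)
  also have "\<dots> = (\<integral>\<^sup>+v. (\<integral>\<^sup>+y. n s v * (n a y * F (v + y)) \<partial>lborel) \<partial>lborel)"
    by (simp add: nn_integral_cmult)
  also have "\<dots> = (\<integral>\<^sup>+y. (\<integral>\<^sup>+v. n s v * (n a y * F (v + y)) \<partial>lborel) \<partial>lborel)"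
    by (rule lborel_pair.Fubini') measurable
  also have "\<dots> = (\<integral>\<^sup>+y. (\<integral>\<^sup>+w. n s (w - y) * (n a y * F w) \<partial>lborel) \<partial>lborel)"
  proof (rule nn_integral_cong)
    fix y
    show "(\<integral>\<^sup>+v. n s v * (n a y * F (v + y)) \<partial>lborel) = (\<integral>\<^sup>+w. n s (w - y) * (n a y * F w) \<partial>lborel)"
      using nn_integral_real_affine[of "\<lambda>v. n s v * (n a y * F (v + y))" 1 "- y"] by simp
  qed
  also have "\<dots> = (\<integral>\<^sup>+w. (\<integral>\<^sup>+y. n s (w - y) * (n a y * F w) \<partial>lborel) \<partial>lborel)"
    by (rule lborel_pair.Fubini') measurable
  also have "\<dots> = (\<integral>\<^sup>+w. (\<integral>\<^sup>+y. ennreal (normal_density 0 s (w - y) * normal_density 0 a y) \<partial>lborel) * F w \<partial>lborel)"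
    by (subst nn_integral_multc[symmetric]) (auto simp: n_def ennreal_mult' mult_ac intro!: nn_integral_cong)
  also have "\<dots> = (\<integral>\<^sup>+w. n (sqrt (s\<^sup>2 + a\<^sup>2)) w * F w \<partial>lborel)"
    using fun_cong[OF conv_normal_density_zero_mean[OF s a]] by (simp add: n_def)
  also have "\<dots> = gauss_moment p (sqrt (s\<^sup>2 + a\<^sup>2)) x"
    using gm[of "sqrt (s\<^sup>2 + a\<^sup>2)" 0] s by (simp add: sum_power2_gt_zero_iff)
  finally show ?thesis .
qed

text \<open>
  Integrate \<open>powr_second_difference\<close> at \<open>t = a z\<close> over a standard Gaussian \<open>z\<close>. Since \<open>z\<^sup>2\<close> has mean \<open>1\<close>, the two
  \<open>\<kappa>\<close>-terms become equal and cancel.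
\<close>

lemma two_point_le_gauss_moment:
  assumes p: "p \<ge> 3"
  shows "ennreal (\<bar>y + a\<bar> powr p) + ennreal (\<bar>y - a\<bar> powr p) \<le> 2 * gauss_moment p \<bar>a\<bar> y"
proof (cases "a = 0")
  case True
  then show ?thesis by (simp add: gauss_moment_0 mult_2)
next
  case False
  define b where "b = \<bar>a\<bar>"
  have b: "b > 0" using False by (simp add: b_def)
  obtain \<kappa> where \<kappa>: "\<kappa> \<ge> 0"
    "\<And>t. \<bar>y + b\<bar> powr p + \<bar>y - b\<bar> powr p + \<kappa> * t\<^sup>2 \<le> \<bar>y + t\<bar> powr p + \<bar>y - t\<bar> powr p + \<kappa> * b\<^sup>2"
    using powr_second_difference[OF p b] by metis
  let ?n = "\<lambda>z. ennreal (std_normal_density z)"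
  define L where "L = \<bar>y + b\<bar> powr p + \<bar>y - b\<bar> powr p"
  have L: "L \<ge> 0" by (simp add: L_def)
  have m2: "(\<integral>\<^sup>+z. ?n z * ennreal (z\<^sup>2) \<partial>lborel) = 1"
    using std_normal_moment_even[of 1]
    by (simp add: has_bochner_integral_iff nn_integral_eq_integral flip: ennreal_mult')
  have refl: "(\<integral>\<^sup>+z. ?n z * ennreal (\<bar>y - b * z\<bar> powr p) \<partial>lborel) = gauss_moment p b y"
    unfolding gauss_moment_def
    by (subst nn_integral_real_affine[of _ "-1" 0]) (auto simp: std_normal_density_def)
  have "ennreal L + ennreal (\<kappa> * b\<^sup>2) = (\<integral>\<^sup>+z. ?n z * ennreal L + ?n z * ennreal (z\<^sup>2) * ennreal (\<kappa> * b\<^sup>2) \<partial>lborel)"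
    by (simp add: nn_integral_add nn_integral_multc nn_integral_std_normal m2)
  also have "\<dots> \<le> (\<integral>\<^sup>+z. ?n z * ennreal (\<bar>y + b * z\<bar> powr p) + ?n z * ennreal (\<bar>y - b * z\<bar> powr p)
                    + ?n z * ennreal (\<kappa> * b\<^sup>2) \<partial>lborel)"
  proof (rule nn_integral_mono)
    fix z
    have "L + z\<^sup>2 * (\<kappa> * b\<^sup>2) \<le> \<bar>y + b * z\<bar> powr p + \<bar>y - b * z\<bar> powr p + \<kappa> * b\<^sup>2"
      using \<kappa>(2)[of "b * z"] by (simp add: L_def power_mult_distrib mult_ac)
    then have "std_normal_density z * (L + z\<^sup>2 * (\<kappa> * b\<^sup>2))
        \<le> std_normal_density z * (\<bar>y + b * z\<bar> powr p + \<bar>y - b * z\<bar> powr p + \<kappa> * b\<^sup>2)"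
      by (intro mult_left_mono) auto
    then show "?n z * ennreal L + ?n z * ennreal (z\<^sup>2) * ennreal (\<kappa> * b\<^sup>2) \<le>
        ?n z * ennreal (\<bar>y + b * z\<bar> powr p) + ?n z * ennreal (\<bar>y - b * z\<bar> powr p) + ?n z * ennreal (\<kappa> * b\<^sup>2)"
      using \<kappa>(1) L by (simp add: ennreal_mult'[symmetric] ennreal_plus[symmetric] distrib_left ennreal_leI mult.assoc del: ennreal_plus)
  qed
  also have "\<dots> = (gauss_moment p b y + gauss_moment p b y) + ennreal (\<kappa> * b\<^sup>2)"
    by (simp add: nn_integral_add nn_integral_multc nn_integral_std_normal refl)
       (simp add: gauss_moment_def)
  finally have "ennreal L \<le> gauss_moment p b y + gauss_moment p b y"
    by (simp add: add.commute ennreal_add_left_cancel_le)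
  moreover have "ennreal L = ennreal (\<bar>y + a\<bar> powr p) + ennreal (\<bar>y - a\<bar> powr p)"
    by (cases "a \<ge> 0") (simp_all add: L_def b_def add.commute)
  ultimately show ?thesis by (simp add: b_def mult_2)
qed

lemma gauss_moment_two_point:
  assumes p: "p \<ge> 3" and s: "s \<ge> 0"
  shows "gauss_moment p s (x + a) + gauss_moment p s (x - a) \<le> 2 * gauss_moment p (sqrt (s\<^sup>2 + a\<^sup>2)) x"
proof -
  let ?n = "\<lambda>z. ennreal (std_normal_density z)"
  have "gauss_moment p s (x + a) + gauss_moment p s (x - a)
      = (\<integral>\<^sup>+z. ?n z * (ennreal (\<bar>x + s * z + a\<bar> powr p) + ennreal (\<bar>x + s * z - a\<bar> powr p)) \<partial>lborel)"
    unfolding gauss_moment_def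
    by (subst nn_integral_add[symmetric]) (auto simp: distrib_left algebra_simps)
  also have "\<dots> \<le> (\<integral>\<^sup>+z. ?n z * (2 * gauss_moment p \<bar>a\<bar> (x + s * z)) \<partial>lborel)"
    by (intro nn_integral_mono mult_left_mono two_point_le_gauss_moment p) auto
  also have "\<dots> = (\<integral>\<^sup>+z. 2 * (?n z * gauss_moment p \<bar>a\<bar> (x + s * z)) \<partial>lborel)"
    by (simp only: mult.left_commute)
  also have "\<dots> = 2 * (\<integral>\<^sup>+z. ?n z * gauss_moment p \<bar>a\<bar> (x + s * z) \<partial>lborel)"
    by (rule nn_integral_cmult) measurable
  also have "\<dots> = 2 * gauss_moment p (sqrt (s\<^sup>2 + a\<^sup>2)) x"
    using gauss_moment_convolution[OF s, of "\<bar>a\<bar>" p x] by simp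
  finally show ?thesis .
qed

section \<open>Khintchine's inequality with the Gaussian constant\<close>

definition fair_sign :: "'a measure \<Rightarrow> ('a \<Rightarrow> real) \<Rightarrow> bool" where
  "fair_sign M X \<longleftrightarrow> (\<forall>\<omega>\<in>space M. X \<omega> \<in> {-1, 1}) \<and>
     measure M {\<omega> \<in> space M. X \<omega> = 1} = 1 / 2 \<and> measure M {\<omega> \<in> space M. X \<omega> = -1} = 1 / 2"

lemma (in prob_space) nn_integral_fair_sign:
  assumes X: "fair_sign M X" and ind: "indep_var borel X borel Y"
    and [measurable]: "F \<in> borel_measurable (borel \<Otimes>\<^sub>M borel)"
  shows "(\<integral>\<^sup>+\<omega>. F (X \<omega>, Y \<omega>) \<partial>M) = (\<integral>\<^sup>+\<omega>. (F (1, Y \<omega>) + F (-1, Y \<omega>)) / 2 \<partial>M)"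
proof -
  have [measurable]: "X \<in> borel_measurable M" "Y \<in> borel_measurable M"
    using ind by (auto dest: indep_var_rv1 indep_var_rv2)
  interpret Y: prob_space "distr M borel Y" by (rule prob_space_distr) simp
  interpret X: prob_space "distr M borel X" by (rule prob_space_distr) simp
  interpret P: pair_prob_space "distr M borel X" "distr M borel Y" ..
  have m: "measure M {\<omega> \<in> space M. X \<omega> = 1} = 1 / 2" "measure M {\<omega> \<in> space M. X \<omega> = -1} = 1 / 2"
    using X by (simp_all add: fair_sign_def)
  have inner: "(\<integral>\<^sup>+\<omega>. F (X \<omega>, y) \<partial>M) = (F (1, y) + F (-1, y)) / 2" for y
  proof -
    have "(\<integral>\<^sup>+\<omega>. F (X \<omega>, y) \<partial>M)
        = (\<integral>\<^sup>+\<omega>. F (1, y) * indicator {\<omega> \<in> space M. X \<omega> = 1} \<omega>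
             + F (-1, y) * indicator {\<omega> \<in> space M. X \<omega> = -1} \<omega> \<partial>M)"
      using X by (intro nn_integral_cong) (auto simp: fair_sign_def indicator_def)
    also have "\<dots> = F (1, y) * ennreal (1 / 2) + F (-1, y) * ennreal (1 / 2)"
      by (simp add: nn_integral_add nn_integral_cmult emeasure_eq_measure m)
    finally show ?thesis
      by (simp add: ennreal_divide_numeral[symmetric] divide_ennreal_def distrib_right)
  qed
  have "(\<integral>\<^sup>+\<omega>. F (X \<omega>, Y \<omega>) \<partial>M) = (\<integral>\<^sup>+z. F z \<partial>distr M (borel \<Otimes>\<^sub>M borel) (\<lambda>\<omega>. (X \<omega>, Y \<omega>)))"
    by (subst nn_integral_distr) auto
  also have "\<dots> = (\<integral>\<^sup>+z. F z \<partial>(distr M borel X \<Otimes>\<^sub>M distr M borel Y))"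
    using ind by (simp add: indep_var_distribution_eq)
  also have "\<dots> = (\<integral>\<^sup>+y. \<integral>\<^sup>+x. F (x, y) \<partial>distr M borel X \<partial>distr M borel Y)"
    by (subst P.nn_integral_snd[symmetric]) (auto cong: measurable_cong_sets)
  also have "\<dots> = (\<integral>\<^sup>+\<omega>. (F (1, Y \<omega>) + F (-1, Y \<omega>)) / 2 \<partial>M)"
    by (simp add: nn_integral_distr inner)
  finally show ?thesis .
qed

text \<open>
  The Gaussian part \<open>s\<close> is arbitrary in the induction, since it absorbs the signs that are already replaced.
\<close>

lemma (in prob_space) khintchine_gauss:
  fixes X :: "'i \<Rightarrow> 'a \<Rightarrow> real"
  assumes p: "p \<ge> 3" and "finite G" and "indep_vars (\<lambda>_. borel) X G"
    and "\<And>i. i \<in> G \<Longrightarrow> fair_sign M (X i)" and "s \<ge> 0"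
  shows "(\<integral>\<^sup>+\<omega>. gauss_moment p s (x + (\<Sum>i\<in>G. X i \<omega> * a i)) \<partial>M)
           \<le> gauss_moment p (sqrt (s\<^sup>2 + (\<Sum>i\<in>G. (a i)\<^sup>2))) x"
  using assms(2-)
proof (induction G arbitrary: s rule: finite_induct)
  case empty
  then show ?case by (simp add: emeasure_space_1)
next
  case (insert j G)
  define Y where "Y \<omega> = (\<Sum>i\<in>G. X i \<omega> * a i)" for \<omega>
  have indG: "indep_vars (\<lambda>_. borel) X G"
    by (rule indep_vars_subset[OF insert.prems(1)]) auto
  have ind: "indep_var borel (X j) borel Y"
  proof -
    \<comment> \<open>The sign \<open>X j\<close> itself must be independent of the weighted sum, so only the other summands are scaled.\<close>
    have "indep_vars (\<lambda>_. borel) (\<lambda>i \<omega>. (if i = j then X i \<omega> else X i \<omega> * a i)) (insert j G)"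
      by (rule indep_vars_compose2[OF insert.prems(1), of "\<lambda>i t. if i = j then t else t * a i"]) auto
    note indep_vars_sum[OF insert.hyps this]
    moreover have "(\<Sum>i\<in>G. if i = j then X i \<omega> else X i \<omega> * a i) = Y \<omega>" for \<omega>
      unfolding Y_def using insert.hyps by (intro sum.cong) auto
    ultimately show ?thesis by simp
  qed
  have [measurable]: "Y \<in> borel_measurable M" using ind by (auto dest: indep_var_rv2)
  let ?s = "sqrt (s\<^sup>2 + (a j)\<^sup>2)"
  have "(\<integral>\<^sup>+\<omega>. gauss_moment p s (x + (\<Sum>i\<in>insert j G. X i \<omega> * a i)) \<partial>M)
      = (\<integral>\<^sup>+\<omega>. (\<lambda>(t, y). gauss_moment p s (x + y + t * a j)) (X j \<omega>, Y \<omega>) \<partial>M)"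
    using insert.hyps by (simp add: Y_def add_ac)
  also have "\<dots> = (\<integral>\<^sup>+\<omega>. (gauss_moment p s (x + Y \<omega> + a j) + gauss_moment p s (x + Y \<omega> - a j)) / 2 \<partial>M)"
    using insert.prems by (subst nn_integral_fair_sign[OF _ ind]) auto
  also have "\<dots> \<le> (\<integral>\<^sup>+\<omega>. gauss_moment p ?s (x + Y \<omega>) \<partial>M)"
  proof (rule nn_integral_mono)
    fix \<omega>
    show "(gauss_moment p s (x + Y \<omega> + a j) + gauss_moment p s (x + Y \<omega> - a j)) / 2 \<le> gauss_moment p ?s (x + Y \<omega>)"
      using divide_right_mono_ennreal[OF gauss_moment_two_point[OF p insert.prems(3), of "x + Y \<omega>" "a j"], of 2]
        mult_divide_eq_ennreal[of 2 "gauss_moment p ?s (x + Y \<omega>)"]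
      by (simp add: mult.commute[of 2])
  qed
  also have "\<dots> \<le> gauss_moment p (sqrt (?s\<^sup>2 + (\<Sum>i\<in>G. (a i)\<^sup>2))) x"
    unfolding Y_def by (rule insert.IH[OF indG]) (use insert.prems in auto)
  also have "?s\<^sup>2 + (\<Sum>i\<in>G. (a i)\<^sup>2) = s\<^sup>2 + (\<Sum>i\<in>insert j G. (a i)\<^sup>2)"
    using insert.hyps by simp
  finally show ?case .
qed

text \<open>
  The absolute moment of order \<open>p\<close> of a standard Gaussian, see \<open>std_normal_absolute_moment\<close>.
\<close>

definition khintchine_const :: "real \<Rightarrow> real" where
  "khintchine_const p = 2 powr (p / 2) * Gamma ((p + 1) / 2) / sqrt pi"

lemma khintchine_const_pos: "p > 0 \<Longrightarrow> khintchine_const p > 0"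
  by (simp add: khintchine_const_def Gamma_real_pos)

lemma (in prob_space) khintchine_real:
  fixes X :: "'i \<Rightarrow> 'a \<Rightarrow> real"
  assumes p: "p \<ge> 3" and "finite G" and "indep_vars (\<lambda>_. borel) X G"
    and "\<And>i. i \<in> G \<Longrightarrow> fair_sign M (X i)"
  shows "(\<integral>\<^sup>+\<omega>. ennreal (\<bar>\<Sum>i\<in>G. X i \<omega> * a i\<bar> powr p) \<partial>M)
           \<le> ennreal (khintchine_const p * (\<Sum>i\<in>G. (a i)\<^sup>2) powr (p / 2))"
proof -
  have "(\<integral>\<^sup>+\<omega>. ennreal (\<bar>\<Sum>i\<in>G. X i \<omega> * a i\<bar> powr p) \<partial>M) \<le> gauss_moment p (sqrt (\<Sum>i\<in>G. (a i)\<^sup>2)) 0"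
    using khintchine_gauss[OF assms, of 0 0 a] by (simp add: gauss_moment_0)
  also have "\<dots> = ennreal (khintchine_const p * (\<Sum>i\<in>G. (a i)\<^sup>2) powr (p / 2))"
    using p by (subst gauss_moment_centred)
      (auto simp: khintchine_const_def powr_half_sqrt[symmetric] powr_powr sum_nonneg)
  finally show ?thesis .
qed

lemma power2_powr_half: "(x\<^sup>2) powr (p / 2) = \<bar>x\<bar> powr p" for x p :: real
proof -
  have "x\<^sup>2 = \<bar>x\<bar> powr 2" by (simp add: powr_numeral)
  then show ?thesis by (simp only: powr_powr) simp
qed

text \<open>
  The squared norm of the sum is a convex combination of the squares of its coordinates, each divided by
  its share \<open>wt b\<close> of the total variance. Convexity of \<open>x powr (p/2)\<close> then reduces to the real case, and
  each coordinate contributes its share of the same bound, so that no constant is lost.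
\<close>

lemma (in prob_space) khintchine_euclidean:
  fixes X :: "'i \<Rightarrow> 'a \<Rightarrow> real" and v :: "'i \<Rightarrow> 'v::euclidean_space"
  assumes p: "p \<ge> 3" and G: "finite G" "indep_vars (\<lambda>_. borel) X G"
    "\<And>i. i \<in> G \<Longrightarrow> fair_sign M (X i)"
  shows "(\<integral>\<^sup>+\<omega>. ennreal (norm (\<Sum>i\<in>G. X i \<omega> *\<^sub>R v i) powr p) \<partial>M)
           \<le> ennreal (khintchine_const p * (\<Sum>i\<in>G. (norm (v i))\<^sup>2) powr (p / 2))"
proof -
  define \<sigma>2 where "\<sigma>2 b = (\<Sum>i\<in>G. (v i \<bullet> b)\<^sup>2)" for b
  define T where "T = (\<Sum>i\<in>G. (norm (v i))\<^sup>2)"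
  have norm_sq: "(norm x)\<^sup>2 = (\<Sum>b\<in>Basis. (x \<bullet> b)\<^sup>2)" for x :: 'v
    using euclidean_inner[of x x] by (simp add: power2_eq_square dot_square_norm)
  have T_eq: "T = (\<Sum>b\<in>Basis. \<sigma>2 b)"
    unfolding T_def \<sigma>2_def norm_sq by (rule sum.swap)
  have \<sigma>2_nonneg: "\<sigma>2 b \<ge> 0" for b by (simp add: \<sigma>2_def sum_nonneg)
  show ?thesis
  proof (cases "T = 0")
    case True
    then have "v i = 0" if "i \<in> G" for i
      using that G(1) unfolding T_def by (subst (asm) sum_nonneg_eq_0_iff) auto
    then show ?thesis using p by (simp add: T_def[symmetric] True)
  next
    case False
    then have T: "T > 0" using T_eq \<sigma>2_nonneg by (metis less_eq_real_def sum_nonneg)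
    define wt where "wt b = \<sigma>2 b / T" for b
    define Z where "Z \<omega> b = (\<Sum>i\<in>G. X i \<omega> * (v i \<bullet> b))" for \<omega> b
    have Xm[measurable]: "X i \<in> borel_measurable M" if "i \<in> G" for i
      using G(2) that by (auto simp: indep_vars_def)
    have [measurable]: "(\<lambda>\<omega>. Z \<omega> b) \<in> borel_measurable M" for b
      unfolding Z_def by (intro borel_measurable_sum borel_measurable_times) auto
    have wt_sum: "(\<Sum>b\<in>Basis. wt b) = 1"
      using T by (simp add: wt_def sum_divide_distrib[symmetric] T_eq[symmetric])
    have wt_nonneg: "wt b \<ge> 0" for b using T \<sigma>2_nonneg by (simp add: wt_def)
    have Z_0: "Z \<omega> b = 0" if "wt b = 0" for \<omega> b
    proof -
      have "\<sigma>2 b = 0" using that T by (simp add: wt_def)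
      then have "v i \<bullet> b = 0" if "i \<in> G" for i
        using that G(1) unfolding \<sigma>2_def by (subst (asm) sum_nonneg_eq_0_iff) auto
      then show ?thesis by (simp add: Z_def)
    qed
    have pointwise: "norm (\<Sum>i\<in>G. X i \<omega> *\<^sub>R v i) powr p
        \<le> (\<Sum>b\<in>Basis. wt b powr (1 - p / 2) * \<bar>Z \<omega> b\<bar> powr p)" for \<omega>
    proof -
      let ?x = "\<Sum>i\<in>G. X i \<omega> *\<^sub>R v i"
      have "norm ?x powr p = ((norm ?x)\<^sup>2) powr (p / 2)"
        by (simp add: power2_powr_half)
      also have "(norm ?x)\<^sup>2 = (\<Sum>b\<in>Basis. wt b *\<^sub>R ((Z \<omega> b)\<^sup>2 / wt b))"
        unfolding norm_sq using Z_0
        by (intro sum.cong) (auto simp: Z_def inner_sum_left)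
      also have "\<dots> powr (p / 2) \<le> (\<Sum>b\<in>Basis. wt b * ((Z \<omega> b)\<^sup>2 / wt b) powr (p / 2))"
        by (rule convex_on_sum[OF _ _ convex_on_powr_nonneg]) (use p wt_sum wt_nonneg in auto)
      also have "\<dots> = (\<Sum>b\<in>Basis. wt b powr (1 - p / 2) * \<bar>Z \<omega> b\<bar> powr p)"
      proof (rule sum.cong[OF refl])
        fix b :: 'v
        show "wt b * ((Z \<omega> b)\<^sup>2 / wt b) powr (p / 2) = wt b powr (1 - p / 2) * \<bar>Z \<omega> b\<bar> powr p"
          using wt_nonneg[of b] Z_0[of b] p by (cases "wt b = 0") (simp_all add: powr_divide powr_diff power2_powr_half)
      qed
      finally show ?thesis .
    qed
    have "(\<integral>\<^sup>+\<omega>. ennreal (norm (\<Sum>i\<in>G. X i \<omega> *\<^sub>R v i) powr p) \<partial>M)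
        \<le> (\<integral>\<^sup>+\<omega>. (\<Sum>b\<in>Basis. ennreal (wt b powr (1 - p / 2)) * ennreal (\<bar>Z \<omega> b\<bar> powr p)) \<partial>M)"
      using pointwise by (intro nn_integral_mono) (simp add: ennreal_mult'[symmetric] ennreal_leI)
    also have "\<dots> = (\<Sum>b\<in>Basis. ennreal (wt b powr (1 - p / 2)) * (\<integral>\<^sup>+\<omega>. ennreal (\<bar>Z \<omega> b\<bar> powr p) \<partial>M))"
      by (simp add: nn_integral_sum nn_integral_cmult)
    also have "\<dots> \<le> (\<Sum>b\<in>Basis. ennreal (wt b powr (1 - p / 2)) * ennreal (khintchine_const p * \<sigma>2 b powr (p / 2)))"
      unfolding Z_def \<sigma>2_def by (intro sum_mono mult_left_mono khintchine_real[OF p G]) auto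
    also have "\<dots> = ennreal (\<Sum>b\<in>Basis. wt b * (khintchine_const p * T powr (p / 2)))"
    proof -
      have "wt b powr (1 - p / 2) * (khintchine_const p * \<sigma>2 b powr (p / 2)) = wt b * (khintchine_const p * T powr (p / 2))" for b
      proof -
        have "\<sigma>2 b = wt b * T" using T by (simp add: wt_def)
        then show ?thesis
          using wt_nonneg[of b] T by (cases "wt b = 0") (simp_all add: powr_mult powr_diff)
      qed
      then have "ennreal (wt b powr (1 - p / 2)) * ennreal (khintchine_const p * \<sigma>2 b powr (p / 2))
          = ennreal (wt b * (khintchine_const p * T powr (p / 2)))" for b
        by (simp only: ennreal_mult'[OF powr_ge_zero, symmetric])
      then show ?thesis
        using khintchine_const_pos[of p] p wt_nonneg by (simp add: sum_ennreal)
    qed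
    also have "(\<Sum>b\<in>Basis. wt b * (khintchine_const p * T powr (p / 2))) = khintchine_const p * T powr (p / 2)"
      using wt_sum by (simp flip: sum_distrib_right)
    finally show ?thesis by (simp add: T_def)
  qed
qed

section \<open>Translation invariance on the torus\<close>

text \<open>
  The half-open version of the box that carries the torus measure: unlike the closed box, its lattice translates tile
  the whole space without overlap.
\<close>

definition cell :: "(real^3) set" where
  "cell = {x. \<forall>i. 0 \<le> x $ i \<and> x $ i < 2 * pi}"

definition lattice_point :: "int^3 \<Rightarrow> real^3" where
  "lattice_point k = (\<chi> i. 2 * pi * of_int (k $ i))"

lemma lattice_cell_iff: "x + lattice_point k \<in> cell \<longleftrightarrow> k = (\<chi> i. - \<lfloor>x $ i / (2 * pi)\<rfloor>)"
proof -
  have "0 \<le> x $ i + 2 * pi * of_int m \<and> x $ i + 2 * pi * of_int m < 2 * pi \<longleftrightarrow> m = - \<lfloor>x $ i / (2 * pi)\<rfloor>" for i and m :: int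
  proof -
    have "0 \<le> x $ i + 2 * pi * of_int m \<longleftrightarrow> - of_int m \<le> x $ i / (2 * pi)"
      by (simp add: field_simps) argo
    moreover have "x $ i + 2 * pi * of_int m < 2 * pi \<longleftrightarrow> x $ i / (2 * pi) < - of_int m + 1"
      by (simp add: field_simps)
    ultimately show ?thesis
      using floor_eq_iff[of "x $ i / (2 * pi)" "- m"] by (metis minus_minus of_int_minus)
  qed
  then show ?thesis by (auto simp: cell_def lattice_point_def vec_eq_iff)
qed

lemma sets_cell [measurable]: "cell \<in> sets borel"
proof -
  have "cell = (\<Inter>i. {x. 0 \<le> x $ i} \<inter> {x. x $ i < 2 * pi})" by (auto simp: cell_def)
  also have "\<dots> \<in> sets borel"
    by (intro sets.finite_INT sets.Int borel_closed borel_open closed_Collect_le open_Collect_less continuous_intros) auto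
  finally show ?thesis .
qed

lemma nn_integral_lborel_shift:
  fixes f :: "'b::euclidean_space \<Rightarrow> ennreal"
  assumes [measurable]: "f \<in> borel_measurable borel"
  shows "(\<integral>\<^sup>+x. f (x + h) \<partial>lborel) = (\<integral>\<^sup>+x. f x \<partial>lborel)"
proof -
  have "(\<integral>\<^sup>+x. f x \<partial>lborel) = (\<integral>\<^sup>+x. f x \<partial>distr lborel borel ((+) h))"
    by (simp add: lborel_distr_plus)
  also have "\<dots> = (\<integral>\<^sup>+x. f (x + h) \<partial>lborel)"
    by (subst nn_integral_distr) (auto simp: add.commute)
  finally show ?thesis by simp
qed

lemma lattice_tiling: "(\<integral>\<^sup>+k. indicator cell (y + lattice_point k) \<partial>count_space UNIV) = 1"
proof -
  let ?k = "\<chi> i. - \<lfloor>y $ i / (2 * pi)\<rfloor>"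
  have "(\<integral>\<^sup>+k. indicator cell (y + lattice_point k) \<partial>count_space UNIV)
      = (\<integral>\<^sup>+k. indicator {?k} k \<partial>count_space UNIV)"
    by (intro nn_integral_cong) (auto simp: indicator_def lattice_cell_iff)
  then show ?thesis by simp
qed

text \<open>
  The shifted cell is cut into its pieces in the lattice translates of \<open>cell\<close>. Translating every piece back
  changes nothing for a periodic integrand, and the pieces then tile \<open>cell\<close> again.
\<close>

lemma cell_shift_invariance:
  fixes g :: "real^3 \<Rightarrow> ennreal"
  assumes [measurable]: "g \<in> borel_measurable borel"
    and per: "\<And>k x. g (x + lattice_point k) = g x"
  shows "(\<integral>\<^sup>+x. indicator cell x * g (x + h) \<partial>lborel) = (\<integral>\<^sup>+x. indicator cell x * g x \<partial>lborel)"
proof -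
  interpret C: sigma_finite_measure "count_space (UNIV :: (int^3) set)"
    by (rule sigma_finite_measure_count_space)
  interpret P: pair_sigma_finite "count_space (UNIV :: (int^3) set)" lborel ..
  have neg: "(\<integral>\<^sup>+k. f (lattice_point k) \<partial>count_space UNIV) = (\<integral>\<^sup>+k. f (- lattice_point k) \<partial>count_space UNIV)"
    for f :: "real^3 \<Rightarrow> ennreal"
  proof -
    have "lattice_point (- k) = - lattice_point k" for k
      by (simp add: lattice_point_def vec_eq_iff)
    moreover have "bij (uminus :: int^3 \<Rightarrow> int^3)" by (rule bij_uminus)
    ultimately show ?thesis
      using nn_integral_bij_count_space[of uminus UNIV UNIV "\<lambda>k. f (lattice_point k)"] by simp
  qed
  have m: "(\<lambda>(k, x). F x k) \<in> borel_measurable (count_space (UNIV :: (int^3) set) \<Otimes>\<^sub>M lborel)"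
    if "\<And>k. (\<lambda>x. F x k) \<in> borel_measurable borel" for F :: "real^3 \<Rightarrow> int^3 \<Rightarrow> ennreal"
    using that by (intro measurable_pair_measure_countable1) auto
  have "(\<integral>\<^sup>+x. indicator cell x * g (x + h) \<partial>lborel) = (\<integral>\<^sup>+x. indicator cell (x - h) * g x \<partial>lborel)"
    using nn_integral_lborel_shift[of "\<lambda>x. indicator cell (x - h) * g x" h] by simp
  \<comment> \<open>Exactly one lattice translate of each point lies in \<open>cell\<close>.\<close>
  also have "\<dots> = (\<integral>\<^sup>+x. \<integral>\<^sup>+k. indicator cell (x - h) * g x * indicator cell (x + lattice_point k) \<partial>count_space UNIV \<partial>lborel)"
    by (simp add: nn_integral_cmult lattice_tiling)
  also have "\<dots> = (\<integral>\<^sup>+k. \<integral>\<^sup>+x. indicator cell (x - h) * g x * indicator cell (x + lattice_point k) \<partial>lborel \<partial>count_space UNIV)"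
    by (rule P.Fubini') (rule m, measurable)
  also have "\<dots> = (\<integral>\<^sup>+k. \<integral>\<^sup>+x. indicator cell (x - h - lattice_point k) * g x * indicator cell x \<partial>lborel \<partial>count_space UNIV)"
  proof (rule nn_integral_cong)
    fix k :: "int^3"
    have "g x = g (x - lattice_point k)" for x using per[of "x - lattice_point k" k] by simp
    then show "(\<integral>\<^sup>+x. indicator cell (x - h) * g x * indicator cell (x + lattice_point k) \<partial>lborel)
        = (\<integral>\<^sup>+x. indicator cell (x - h - lattice_point k) * g x * indicator cell x \<partial>lborel)"
      using nn_integral_lborel_shift[of "\<lambda>x. indicator cell (x - h - lattice_point k) * g x * indicator cell x" "lattice_point k"]
      by (simp add: per add_diff_eq[symmetric] diff_diff_eq2)
  qed
  also have "\<dots> = (\<integral>\<^sup>+x. \<integral>\<^sup>+k. indicator cell x * g x * indicator cell (x - h - lattice_point k) \<partial>count_space UNIV \<partial>lborel)"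
    by (subst P.Fubini'[OF m, symmetric]) (auto simp: mult_ac)
  also have "\<dots> = (\<integral>\<^sup>+x. indicator cell x * g x \<partial>lborel)"
  proof -
    have "(\<integral>\<^sup>+k. indicator cell (x - h - lattice_point k) \<partial>count_space UNIV) = 1" for x
      using neg[of "\<lambda>v. indicator cell (x - h + v)"] lattice_tiling[of "x - h"] by simp
    then show ?thesis by (simp add: nn_integral_cmult)
  qed
  finally show ?thesis .
qed

lemma emeasure_torus_box: "emeasure lborel (cbox 0 (\<chi> i. 2 * pi) :: (real^3) set) = ennreal ((2 * pi) ^ 3)"
proof -
  have "cbox 0 (\<chi> i. 2 * pi) \<noteq> ({} :: (real^3) set)"
    by (auto simp: interval_ne_empty_cart)
  then have "measure lborel (cbox 0 (\<chi> i. 2 * pi) :: (real^3) set) = (2 * pi) ^ 3"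
    by (simp add: content_cbox_cart)
  then show ?thesis
    by (subst emeasure_eq_ennreal_measure) (auto simp: emeasure_lborel_cbox_eq)
qed

lemma prob_space_torus: "prob_space torus"
  unfolding torus_def by (rule prob_space_uniform_measure) (auto simp: emeasure_torus_box)

lemma sets_torus [simp, measurable_cong]: "sets torus = sets borel"
  by (simp add: torus_def)

lemma space_torus [simp]: "space torus = UNIV"
  by (simp add: torus_def)

lemma AE_cell_cbox: "AE x in lborel. x \<in> cbox 0 (\<chi> i. 2 * pi) \<longleftrightarrow> x \<in> cell"
proof -
  have "AE x in lborel. x $ i \<noteq> 2 * pi" for i :: 3
  proof -
    have "negligible {x :: real^3. x \<bullet> axis i 1 = 2 * pi}"
      by (rule negligible_standard_hyperplane) (auto simp: Basis_vec_def)
    then have "{x :: real^3. x $ i = 2 * pi} \<in> null_sets lebesgue"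
      by (simp add: negligible_iff_null_sets inner_axis)
    moreover have "{x :: real^3. x $ i = 2 * pi} \<in> sets lborel"
      by (simp add: borel_closed closed_Collect_eq continuous_on_component continuous_on_const)
    ultimately show ?thesis
      by (intro AE_I'[of "{x. x $ i = 2 * pi}"]) (auto simp: null_sets_completion_iff)
  qed
  then have "AE x in lborel. \<forall>i\<in>UNIV. (x :: real^3) $ i \<noteq> 2 * pi"
    by (subst AE_finite_all) auto
  then show ?thesis
    by (rule eventually_mono) (auto simp: cell_def mem_box_cart order_le_less)
qed

lemma nn_integral_torus:
  assumes [measurable]: "g \<in> borel_measurable borel"
  shows "(\<integral>\<^sup>+x. g x \<partial>torus) = (\<integral>\<^sup>+x. indicator cell x * g x \<partial>lborel) / ennreal ((2 * pi) ^ 3)"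
proof -
  have "(\<integral>\<^sup>+x. g x \<partial>torus) = (\<integral>\<^sup>+x. g x * indicator (cbox 0 (\<chi> i. 2 * pi)) x \<partial>lborel) / ennreal ((2 * pi) ^ 3)"
    unfolding torus_def by (subst nn_integral_uniform_measure) (auto simp: emeasure_torus_box)
  also have "(\<integral>\<^sup>+x. g x * indicator (cbox 0 (\<chi> i. 2 * pi)) x \<partial>lborel) = (\<integral>\<^sup>+x. indicator cell x * g x \<partial>lborel)"
    by (intro nn_integral_cong_AE eventually_mono[OF AE_cell_cbox]) (auto simp: indicator_def)
  finally show ?thesis .
qed

lemma nn_integral_torus_shift:
  assumes g: "g \<in> borel_measurable borel" and per: "\<And>k x. g (x + lattice_point k) = g x"
  shows "(\<integral>\<^sup>+x. g (x + h) \<partial>torus) = (\<integral>\<^sup>+x. g x \<partial>torus)"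
  using cell_shift_invariance[OF g per, of h] g by (simp add: nn_integral_torus)

lemma AE_torus_shift:
  assumes [measurable]: "Measurable.pred borel P" and per: "\<And>k x. P (x + lattice_point k) = P x"
    and ae: "AE x in torus. P x"
  shows "AE x in torus. P (x + h)"
proof -
  have "(\<integral>\<^sup>+x. indicator {x. \<not> P x} (x + h) \<partial>torus) = (\<integral>\<^sup>+x. indicator {x. \<not> P x} x \<partial>torus)"
    by (rule nn_integral_torus_shift) (auto simp: per indicator_def)
  also have "\<dots> = 0"
    using ae by (subst nn_integral_0_iff_AE) (auto simp: indicator_def)
  finally show ?thesis
    by (subst (asm) nn_integral_0_iff_AE) (auto simp: indicator_def)
qed

section \<open>Parseval's identity\<close>

lemma measurable_wave [measurable]: "wave k \<in> borel_measurable borel"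
  unfolding wave_def[abs_def] by (intro borel_measurable_continuous_onI continuous_intros)

lemma wave_add: "wave k (x + h) = wave k x * wave k h"
  by (simp add: wave_def exp_add[symmetric] algebra_simps sum.distrib)

lemma wave_diff_freq: "wave (k - m) x = wave k x * cnj (wave m x)"
  by (simp add: wave_def exp_add[symmetric] exp_cnj algebra_simps sum_subtractf exp_diff exp_minus divide_inverse)

lemma wave_0 [simp]: "wave 0 x = 1" "wave k 0 = 1"
  by (simp_all add: wave_def)

lemma norm_wave [simp]: "norm (wave k x) = 1"
  unfolding wave_def norm_exp_i_times ..

lemma wave_lattice: "wave k (x + lattice_point m) = wave k x"
proof -
  let ?n = "\<Sum>i\<in>UNIV. k $ i * m $ i"
  have "(\<Sum>i\<in>UNIV. of_int (k $ i) * lattice_point m $ i) = 2 * of_int ?n * pi"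
    by (simp add: lattice_point_def sum_distrib_left sum_distrib_right mult_ac)
  then have "wave k (lattice_point m) = exp (\<i> * of_real (2 * of_int ?n * pi))"
    by (simp only: wave_def)
  also have "\<dots> = 1" using exp_integer_2pi[of "of_int ?n", OF Ints_of_int] by (simp add: mult_ac)
  finally show ?thesis by (simp add: wave_add)
qed

lemma exists_wave_neg:
  assumes "k \<noteq> 0"
  obtains h where "wave k h = -1"
proof -
  obtain i where i: "k $ i \<noteq> 0" using assms by (auto simp: vec_eq_iff)
  define h :: "real^3" where "h = (\<chi> j. if j = i then pi / of_int (k $ i) else 0)"
  have "(\<Sum>j\<in>UNIV. of_int (k $ j) * h $ j) = pi"
    using i by (simp add: h_def if_distrib sum.delta cong: if_cong)
  then have "wave k h = -1" by (simp add: wave_def)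
  then show thesis by (rule that)
qed

lemma integrable_Re_wave: "integrable torus (\<lambda>x. Re (z * wave k x))"
proof -
  interpret prob_space torus by (rule prob_space_torus)
  have "norm (Re (z * wave k x)) \<le> norm z" for x
    using abs_Re_le_cmod[of "z * wave k x"] by (simp add: norm_mult)
  then show ?thesis by (intro integrable_const_bound[of _ "norm z"] AE_I2) auto
qed

text \<open>
  By translation invariance the integral does not change when \<open>x\<close> is shifted by some \<open>h\<close> with
  \<open>wave k h = -1\<close>, but the integrand changes its sign.
\<close>

lemma integral_Re_wave:
  assumes k: "k \<noteq> 0"
  shows "(\<integral>x. Re (z * wave k x) \<partial>torus) = 0"
proof -
  interpret prob_space torus by (rule prob_space_torus)
  obtain h where h: "wave k h = -1" using exists_wave_neg[OF k] .
  have bd: "\<bar>Re (z * wave k x)\<bar> \<le> norm z" for x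
    using abs_Re_le_cmod[of "z * wave k x"] by (simp add: norm_mult)
  have int: "integrable torus (\<lambda>x. Re (z * wave k x))"
    by (rule integrable_Re_wave)
  \<comment> \<open>Adding \<open>norm z\<close> makes the integrand nonnegative, as invariance is known for nonnegative integrals.\<close>
  define J where "J s = (\<integral>\<^sup>+x. ennreal (norm z + s * Re (z * wave k x)) \<partial>torus)" for s
  have J: "J s = ennreal (norm z + s * (\<integral>x. Re (z * wave k x) \<partial>torus))" if "\<bar>s\<bar> = 1" for s
  proof -
    have "0 \<le> norm z + s * Re (z * wave k x)" for x
      using bd[of x] that by (cases "s = 1") (auto simp: abs_if split: if_splits)
    then show ?thesis unfolding J_def using int
      by (subst nn_integral_eq_integral) (auto simp: prob_space[simplified] simp del: times_complex.sel)
  qed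
  have "J 1 = (\<integral>\<^sup>+x. ennreal (norm z + Re (z * wave k (x + h))) \<partial>torus)"
    unfolding J_def mult_1 by (rule nn_integral_torus_shift[symmetric]) (auto simp: wave_lattice)
  also have "\<dots> = J (-1)"
    by (simp add: J_def wave_add h)
  finally have "J 1 = J (-1)" .
  moreover have "\<bar>\<integral>x. Re (z * wave k x) \<partial>torus\<bar> \<le> norm z"
    using integral_mono[OF integrable_abs[OF int] integrable_const[of "norm z"]] bd
    by (intro order_trans[OF integral_abs_bound])
       (simp add: prob_space[simplified] del: times_complex.sel)
  ultimately show ?thesis by (simp add: J abs_le_iff)
qed

lemma vector_norm_sq: "(norm (v :: complex^3))\<^sup>2 = (\<Sum>i\<in>UNIV. (norm (v $ i))\<^sup>2)"
  by (simp add: norm_vec_def L2_set_def sum_nonneg)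

definition L2_sq :: "(real^3 \<Rightarrow> complex^3) \<Rightarrow> ennreal" where
  "L2_sq f = (\<integral>\<^sup>+x. ennreal ((norm (f x))\<^sup>2) \<partial>torus)"

lemma L2_sq_trig_poly:
  assumes F: "finite F"
  shows "L2_sq (\<lambda>x. \<Sum>k\<in>F. wave k x *s c k) = (\<Sum>k\<in>F. ennreal ((norm (c k))\<^sup>2))"
proof -
  interpret prob_space torus by (rule prob_space_torus)
  let ?e = "\<lambda>k m i x. Re (c k $ i * cnj (c m $ i) * wave (k - m) x)"
  note int = integrable_Re_wave
  have eq: "(norm (\<Sum>k\<in>F. wave k x *s c k))\<^sup>2 = (\<Sum>i\<in>UNIV. \<Sum>k\<in>F. \<Sum>m\<in>F. ?e k m i x)" for x
  proof -
    have "(norm (\<Sum>k\<in>F. wave k x * c k $ i))\<^sup>2 = (\<Sum>k\<in>F. \<Sum>m\<in>F. ?e k m i x)" for i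
    proof -
      let ?w = "\<Sum>k\<in>F. wave k x * c k $ i"
      have "(norm ?w)\<^sup>2 = Re (?w * cnj ?w)" by (metis Re_complex_of_real complex_norm_square)
      also have "?w * cnj ?w = (\<Sum>k\<in>F. \<Sum>m\<in>F. c k $ i * cnj (c m $ i) * wave (k - m) x)"
        by (simp add: sum_product wave_diff_freq mult_ac)
      finally show ?thesis by simp
    qed
    then show ?thesis by (simp add: vector_norm_sq)
  qed
  have "L2_sq (\<lambda>x. \<Sum>k\<in>F. wave k x *s c k) = ennreal (\<integral>x. (\<Sum>i\<in>UNIV. \<Sum>k\<in>F. \<Sum>m\<in>F. ?e k m i x) \<partial>torus)"
  proof -
    have nonneg: "0 \<le> (\<Sum>i\<in>UNIV. \<Sum>k\<in>F. \<Sum>m\<in>F. ?e k m i x)" for x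
      using eq[of x] by (metis zero_le_power2)
    then show ?thesis
      unfolding L2_sq_def eq
      by (intro nn_integral_eq_integral Bochner_Integration.integrable_sum int AE_I2 nonneg)
  qed
  also have "(\<integral>x. (\<Sum>i\<in>UNIV. \<Sum>k\<in>F. \<Sum>m\<in>F. ?e k m i x) \<partial>torus)
      = (\<Sum>i\<in>UNIV. \<Sum>k\<in>F. \<Sum>m\<in>F. (\<integral>x. ?e k m i x \<partial>torus))"
    by (subst Bochner_Integration.integral_sum, (intro Bochner_Integration.integrable_sum int)[1], intro sum.cong refl)+
  also have "\<dots> = (\<Sum>i\<in>UNIV. \<Sum>k\<in>F. \<Sum>m\<in>F. if m = k then (norm (c k $ i))\<^sup>2 else 0)"
  proof (intro sum.cong refl)
    fix i k m
    show "(\<integral>x. ?e k m i x \<partial>torus) = (if m = k then (norm (c k $ i))\<^sup>2 else 0)"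
    proof (cases "m = k")
      case True
      have "Re (c k $ i * cnj (c k $ i)) = (norm (c k $ i))\<^sup>2"
        by (metis Re_complex_of_real complex_norm_square)
      then show ?thesis using True by (simp add: prob_space[simplified] del: times_complex.sel)
    next
      case False
      then show ?thesis using integral_Re_wave[of "k - m"] by (simp del: times_complex.sel)
    qed
  qed
  also have "\<dots> = (\<Sum>k\<in>F. (norm (c k))\<^sup>2)"
  proof -
    have "(\<Sum>m\<in>F. if m = k then (norm (c k $ i))\<^sup>2 else 0) = (norm (c k $ i))\<^sup>2" if "k \<in> F" for i k
      using F that by simp
    then have "(\<Sum>i\<in>UNIV. \<Sum>k\<in>F. \<Sum>m\<in>F. if m = k then (norm (c k $ i))\<^sup>2 else 0)
        = (\<Sum>i\<in>UNIV. \<Sum>k\<in>F. (norm (c k $ i))\<^sup>2)"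
      by (intro sum.cong refl) simp
    also have "\<dots> = (\<Sum>k\<in>F. (norm (c k))\<^sup>2)"
      unfolding vector_norm_sq by (rule sum.swap)
    finally show ?thesis .
  qed
  finally show ?thesis by (simp add: sum_ennreal)
qed

text \<open>
  Used to let the parameter of \<open>L2_sq_le_scaled\<close> tend to zero.
\<close>

lemma ennreal_le_of_le_scaled:
  assumes "\<And>e. e > 0 \<Longrightarrow> x \<le> ennreal (1 + e) * y"
  shows "x \<le> y"
proof (rule ennreal_le_epsilon)
  fix e :: real assume y: "y < top" and e: "e > 0"
  define d where "d = e / (enn2real y + 1)"
  have d: "d > 0" using e by (simp add: d_def add_nonneg_pos)
  have "x \<le> ennreal (1 + d) * y" by (rule assms[OF d])
  also have "\<dots> = y + ennreal d * y"
    using d by (simp add: distrib_right)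
  also have "ennreal d * y = ennreal (d * enn2real y)"
    using d y by (simp add: ennreal_mult' less_top)
  also have "\<dots> \<le> ennreal e"
  proof (rule ennreal_leI)
    have "e * z / (z + 1) \<le> e" if "z \<ge> 0" for z
      using that e by (simp add: pos_divide_le_eq algebra_simps)
    then show "d * enn2real y \<le> e" by (simp add: d_def)
  qed
  finally show "x \<le> y + ennreal e" by (simp add: add_left_mono)
qed

lemma torus_periodic_iff: "torus_periodic f \<longleftrightarrow> (\<forall>k x. f (x + lattice_point k) = f x)"
  by (simp add: torus_periodic_def lattice_point_def)

lemma measurable_scale_wave [measurable]: "(\<lambda>x. wave k x *s (v :: complex^3)) \<in> borel_measurable borel"
proof -
  have "continuous_on UNIV (\<lambda>x. wave k x *s v)"
    unfolding wave_def vector_scalar_mult_def by (intro continuous_intros)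
  then show ?thesis by (rule borel_measurable_continuous_onI)
qed

text \<open>
  A squared form of the triangle inequality, with a leading constant arbitrarily close to \<open>1\<close>; it replaces
  Minkowski's inequality in the proof of continuity of the \<open>L\<^sup>2\<close> norm.
\<close>

lemma L2_sq_le_scaled:
  assumes [measurable]: "f \<in> borel_measurable borel" "g \<in> borel_measurable borel" and e: "e > 0"
  shows "L2_sq g \<le> ennreal (1 + e) * L2_sq f + ennreal (1 + 1 / e) * L2_sq (\<lambda>x. f x - g x)"
proof -
  have "(norm (g x))\<^sup>2 \<le> (1 + e) * (norm (f x))\<^sup>2 + (1 + 1 / e) * (norm (f x - g x))\<^sup>2" for x
  proof -
    let ?a = "norm (f x)" and ?b = "norm (f x - g x)"
    have "norm (g x) \<le> ?a + ?b" by (metis norm_minus_commute norm_triangle_sub)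
    then have "(norm (g x))\<^sup>2 \<le> (?a + ?b)\<^sup>2" by (intro power_mono) auto
    also have "\<dots> \<le> (1 + e) * ?a\<^sup>2 + (1 + 1 / e) * ?b\<^sup>2"
    proof -
      have "0 \<le> (e * ?a - ?b)\<^sup>2 / e" using e by simp
      also have "\<dots> = e * ?a\<^sup>2 + ?b\<^sup>2 / e - 2 * ?a * ?b"
        using e by (simp add: power2_eq_square field_simps)
      finally show ?thesis by (simp add: power2_eq_square algebra_simps)
    qed
    finally show ?thesis .
  qed
  then have "L2_sq g \<le> (\<integral>\<^sup>+x. ennreal (1 + e) * ennreal ((norm (f x))\<^sup>2)
        + ennreal (1 + 1 / e) * ennreal ((norm (f x - g x))\<^sup>2) \<partial>torus)"
    unfolding L2_sq_def using e
    by (intro nn_integral_mono)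
       (simp add: ennreal_mult'[symmetric] ennreal_plus[symmetric] ennreal_leI del: ennreal_plus)
  then show ?thesis
    by (simp add: L2_sq_def nn_integral_add nn_integral_cmult)
qed

lemma L2_sq_diff_le:
  assumes [measurable]: "f \<in> borel_measurable borel" "g \<in> borel_measurable borel"
  shows "L2_sq (\<lambda>x. f x - g x) \<le> 2 * L2_sq f + 2 * L2_sq g"
  using L2_sq_le_scaled[of f "\<lambda>x. f x - g x" 1] by (simp add: one_add_one)

lemma L2_fourier_sumD:
  assumes "L2_fourier_sum c f"
  shows "f \<in> borel_measurable borel" "\<And>k x. f (x + lattice_point k) = f x" "L2_sq f < \<infinity>"
    "((\<lambda>F. L2_sq (\<lambda>x. f x - (\<Sum>k\<in>F. wave k x *s c k))) \<longlongrightarrow> 0) (finite_subsets_at_top UNIV)"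
  using assms by (simp_all add: L2_fourier_sum_def torus_periodic_iff L2_sq_def)

lemma L2_fourier_sumI:
  assumes "f \<in> borel_measurable borel" "\<And>k x. f (x + lattice_point k) = f x" "L2_sq f < \<infinity>"
    "((\<lambda>F. L2_sq (\<lambda>x. f x - (\<Sum>k\<in>F. wave k x *s c k))) \<longlongrightarrow> 0) (finite_subsets_at_top UNIV)"
  shows "L2_fourier_sum c f"
  using assms by (simp add: L2_fourier_sum_def torus_periodic_iff L2_sq_def)

text \<open>
  For trigonometric polynomials this is orthogonality of the waves. In the limit, \<open>L2_sq_le_scaled\<close> is applied in
  both directions between the field and its partial sums.
\<close>

lemma parseval:
  assumes "L2_fourier_sum c f"
  shows "((\<lambda>k. ennreal ((norm (c k))\<^sup>2)) has_sum L2_sq f) UNIV"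
proof -
  note f = L2_fourier_sumD[OF assms]
  note [measurable] = f(1)
  let ?T = "finite_subsets_at_top (UNIV :: (int^3) set)"
  define S where "S F = (\<lambda>x. \<Sum>k\<in>F. wave k x *s c k)" for F
  have [measurable]: "S F \<in> borel_measurable borel" for F by (simp add: S_def)
  define a where "a k = ennreal ((norm (c k))\<^sup>2)" for k
  have S: "L2_sq (S F) = sum a F" if "finite F" for F
    using L2_sq_trig_poly[OF that, of c] by (simp add: S_def a_def)
  have D: "((\<lambda>F. L2_sq (\<lambda>x. f x - S F x)) \<longlongrightarrow> 0) ?T" using f(4) by (simp add: S_def)
  have D': "((\<lambda>F. L2_sq (\<lambda>x. S F x - f x)) \<longlongrightarrow> 0) ?T"
    using D by (simp add: L2_sq_def norm_minus_commute)
  have fin: "eventually finite ?T" by (rule eventually_finite_subsets_at_top_weakI) simp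
  have sum: "(sum a \<longlongrightarrow> infsum a UNIV) ?T"
    using has_sum_infsum[OF nonneg_summable_on_complete, of UNIV a] by (simp add: has_sum_def)
  have nz: "?T \<noteq> bot" by simp
  have "infsum a UNIV = L2_sq f"
  proof (rule antisym)
    show "infsum a UNIV \<le> L2_sq f"
    proof (rule ennreal_le_of_le_scaled)
      fix e :: real assume e: "e > 0"
      have lim: "((\<lambda>F. ennreal (1 + e) * L2_sq f + ennreal (1 + 1 / e) * L2_sq (\<lambda>x. f x - S F x))
              \<longlongrightarrow> ennreal (1 + e) * L2_sq f + ennreal (1 + 1 / e) * 0) ?T"
        by (intro tendsto_add tendsto_const ennreal_tendsto_cmult D) auto
      have "infsum a UNIV \<le> ennreal (1 + e) * L2_sq f + ennreal (1 + 1 / e) * 0"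
      proof (rule tendsto_le[OF nz lim sum], rule eventually_mono[OF fin])
        show "sum a F \<le> ennreal (1 + e) * L2_sq f + ennreal (1 + 1 / e) * L2_sq (\<lambda>x. f x - S F x)"
          if "finite F" for F
          using L2_sq_le_scaled[of f "S F" e] e by (simp add: S[OF that])
      qed
      then show "infsum a UNIV \<le> ennreal (1 + e) * L2_sq f" by simp
    qed
    show "L2_sq f \<le> infsum a UNIV"
    proof (rule ennreal_le_of_le_scaled)
      fix e :: real assume e: "e > 0"
      have lim: "((\<lambda>F. ennreal (1 + e) * sum a F + ennreal (1 + 1 / e) * L2_sq (\<lambda>x. S F x - f x))
              \<longlongrightarrow> ennreal (1 + e) * infsum a UNIV + ennreal (1 + 1 / e) * 0) ?T"
        by (intro tendsto_add tendsto_const ennreal_tendsto_cmult D' sum) auto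
      have "L2_sq f \<le> ennreal (1 + e) * infsum a UNIV + ennreal (1 + 1 / e) * 0"
      proof (rule tendsto_le[OF nz lim tendsto_const], rule eventually_mono[OF fin])
        show "L2_sq f \<le> ennreal (1 + e) * sum a F + ennreal (1 + 1 / e) * L2_sq (\<lambda>x. S F x - f x)"
          if "finite F" for F
          using L2_sq_le_scaled[of "S F" f e] e by (simp add: S[OF that])
      qed
      then show "L2_sq f \<le> ennreal (1 + e) * infsum a UNIV" by simp
    qed
  qed
  then show ?thesis using sum by (simp add: has_sum_def a_def[abs_def])
qed

lemma L2_sq_shift:
  assumes "f \<in> borel_measurable borel" "\<And>k x. f (x + lattice_point k) = f x"
  shows "L2_sq (\<lambda>x. f (x + h)) = L2_sq f"
  unfolding L2_sq_def
  by (rule nn_integral_torus_shift[where g = "\<lambda>x. ennreal ((norm (f x))\<^sup>2)"]) (use assms in auto)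

lemma L2_fourier_sum_increment:
  assumes "L2_fourier_sum c f"
  shows "L2_fourier_sum (\<lambda>k. (wave k h - 1) *s c k) (\<lambda>x. f (x + h) - f x)"
proof (rule L2_fourier_sumI)
  note f = L2_fourier_sumD[OF assms]
  note [measurable] = f(1)
  show "(\<lambda>x. f (x + h) - f x) \<in> borel_measurable borel" by measurable
  show "f (x + lattice_point k + h) - f (x + lattice_point k) = f (x + h) - f x" for k x
    using f(2)[of "x + h" k] f(2)[of x k] by (simp add: add_ac)
  have "L2_sq (\<lambda>x. f (x + h) - f x) \<le> 2 * L2_sq (\<lambda>x. f (x + h)) + 2 * L2_sq f"
    by (rule L2_sq_diff_le) auto
  also have "\<dots> < \<infinity>"
    using f(3) unfolding L2_sq_shift[OF f(1,2)] by (simp add: ennreal_mult_less_top)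
  finally show "L2_sq (\<lambda>x. f (x + h) - f x) < \<infinity>" .
  define R where "R F = (\<lambda>x. f x - (\<Sum>k\<in>F. wave k x *s c k))" for F
  have [measurable]: "R F \<in> borel_measurable borel" for F by (simp add: R_def)
  have per: "R F (x + lattice_point k) = R F x" for F x k
    by (simp add: R_def f(2) wave_lattice)
  have le: "L2_sq (\<lambda>x. f (x + h) - f x - (\<Sum>k\<in>F. wave k x *s ((wave k h - 1) *s c k))) \<le> 4 * L2_sq (R F)" for F
  proof -
    have "f (x + h) - f x - (\<Sum>k\<in>F. wave k x *s ((wave k h - 1) *s c k)) = R F (x + h) - R F x" for x
    proof -
      have "(\<Sum>k\<in>F. wave k x *s ((wave k h - 1) *s c k)) = (\<Sum>k\<in>F. wave k (x + h) *s c k) - (\<Sum>k\<in>F. wave k x *s c k)"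
        unfolding sum_subtractf[symmetric]
        by (intro sum.cong refl) (simp add: wave_add vec_eq_iff left_diff_distrib right_diff_distrib)
      then show ?thesis by (simp only: R_def) (simp only: diff_diff_eq2 diff_diff_eq add_diff_eq add_ac diff_add_eq)
    qed
    moreover have "L2_sq (\<lambda>x. R F (x + h) - R F x) \<le> 2 * L2_sq (R F) + 2 * L2_sq (R F)"
      using L2_sq_diff_le[of "\<lambda>x. R F (x + h)" "R F"] L2_sq_shift[of "R F" h] per by simp
    moreover have "2 * L2_sq (R F) + 2 * L2_sq (R F) = 4 * L2_sq (R F)"
      by (simp flip: distrib_right)
    ultimately show ?thesis by simp
  qed
  have "((\<lambda>F. 4 * L2_sq (R F)) \<longlongrightarrow> 4 * 0) (finite_subsets_at_top UNIV)"
    by (intro ennreal_tendsto_cmult) (use f(4) in \<open>simp_all add: R_def\<close>)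
  then have lim: "((\<lambda>F. 4 * L2_sq (R F)) \<longlongrightarrow> 0) (finite_subsets_at_top UNIV)" by simp
  show "((\<lambda>F. L2_sq (\<lambda>x. f (x + h) - f x - (\<Sum>k\<in>F. wave k x *s ((wave k h - 1) *s c k)))) \<longlongrightarrow> 0)
      (finite_subsets_at_top UNIV)"
    by (rule tendsto_sandwich[OF always_eventually[OF allI[OF zero_le]] always_eventually[OF allI[OF le]]
          tendsto_const lim])
qed

lemma L2_fourier_sum_tail:
  assumes "L2_fourier_sum c f" and G: "finite G"
  shows "L2_fourier_sum (\<lambda>k. if k \<in> G then 0 else c k) (\<lambda>x. f x - (\<Sum>k\<in>G. wave k x *s c k))"
proof (rule L2_fourier_sumI)
  note f = L2_fourier_sumD[OF assms(1)]
  note [measurable] = f(1)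
  define S where "S F = (\<lambda>x. \<Sum>k\<in>F. wave k x *s c k)" for F
  have [measurable]: "S F \<in> borel_measurable borel" for F by (simp add: S_def)
  show "(\<lambda>x. f x - (\<Sum>k\<in>G. wave k x *s c k)) \<in> borel_measurable borel" by measurable
  show "f (x + lattice_point k) - (\<Sum>j\<in>G. wave j (x + lattice_point k) *s c j) = f x - (\<Sum>j\<in>G. wave j x *s c j)" for k x
    by (simp add: f(2) wave_lattice)
  have "L2_sq (\<lambda>x. f x - S G x) \<le> 2 * L2_sq f + 2 * L2_sq (S G)"
    by (rule L2_sq_diff_le) auto
  also have "\<dots> < \<infinity>"
  proof -
    have "L2_sq (S G) < \<infinity>" unfolding S_def by (simp add: L2_sq_trig_poly[OF G])
    then show ?thesis using f(3) by (simp add: ennreal_mult_less_top)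
  qed
  finally show "L2_sq (\<lambda>x. f x - (\<Sum>k\<in>G. wave k x *s c k)) < \<infinity>"
    by (simp add: S_def)
  have ev: "eventually (\<lambda>F. finite F \<and> G \<subseteq> F) (finite_subsets_at_top UNIV)"
    using G by (auto simp: eventually_finite_subsets_at_top)
  have "(\<Sum>k\<in>F. wave k x *s (if k \<in> G then 0 else c k)) = S F x - S G x" if F: "finite F" "G \<subseteq> F" for F x
  proof -
    have "S F x - S G x = (\<Sum>k\<in>F - G. wave k x *s c k)"
      unfolding S_def using F by (simp add: sum_diff)
    also have "\<dots> = (\<Sum>k\<in>F. wave k x *s (if k \<in> G then 0 else c k))"
      using F by (intro sum.mono_neutral_cong_left) auto
    finally show ?thesis by simp
  qed
  then have eq: "L2_sq (\<lambda>x. f x - (\<Sum>k\<in>G. wave k x *s c k) - (\<Sum>k\<in>F. wave k x *s (if k \<in> G then 0 else c k)))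
      = L2_sq (\<lambda>x. f x - (\<Sum>k\<in>F. wave k x *s c k))" if "finite F \<and> G \<subseteq> F" for F
    using that by (simp add: S_def)
  show "((\<lambda>F. L2_sq (\<lambda>x. f x - (\<Sum>k\<in>G. wave k x *s c k) - (\<Sum>k\<in>F. wave k x *s (if k \<in> G then 0 else c k)))) \<longlongrightarrow> 0)
      (finite_subsets_at_top UNIV)"
    by (rule Lim_transform_eventually[OF f(4)], rule eventually_mono[OF ev]) (rule eq[symmetric])
qed

section \<open>Structure functions as power means\<close>

lemma sphere_param_eq:
  "sphere_param p = (sin (fst p) * cos (snd p)) *\<^sub>R axis 1 1 + (sin (fst p) * sin (snd p)) *\<^sub>R axis 2 1
     + cos (fst p) *\<^sub>R axis 3 1"
  by (simp add: sphere_param_def case_prod_beta vec_eq_iff forall_3 axis_def)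

lemma measurable_sphere_param [measurable]: "sphere_param \<in> borel_measurable borel"
  unfolding sphere_param_eq[abs_def]
  by (intro borel_measurable_continuous_onI continuous_intros)

lemma norm_sphere_param [simp]: "norm (sphere_param p) = 1"
proof -
  obtain a b where p: "p = (a, b)" by fastforce
  have "(norm (sphere_param p))\<^sup>2 = (sin a * cos b)\<^sup>2 + (sin a * sin b)\<^sup>2 + (cos a)\<^sup>2"
    unfolding p by (simp add: sphere_param_def norm_vec_def L2_set_def sum_3)
  also have "\<dots> = (sin a)\<^sup>2 * ((cos b)\<^sup>2 + (sin b)\<^sup>2) + (cos a)\<^sup>2"
    by (simp only: power_mult_distrib distrib_left)
  also have "\<dots> = 1" by simp
  finally show ?thesis by (simp add: power2_eq_1_iff) (metis norm_ge_zero not_one_le_zero neg_0_le_iff_le)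
qed

lemma sets_unit_sphere_measure [simp, measurable_cong]: "sets unit_sphere_measure = sets borel"
  by (simp add: unit_sphere_measure_def)

lemma space_unit_sphere_measure [simp]: "space unit_sphere_measure = UNIV"
  by (simp add: unit_sphere_measure_def)

lemma AE_unit_sphere: "AE s in unit_sphere_measure. norm s = 1"
  unfolding unit_sphere_measure_def by (subst AE_distr_iff) auto

lemma prob_space_unit_sphere_measure: "prob_space unit_sphere_measure"
proof -
  let ?d = "\<lambda>(a, b). ennreal (sin a / (4 * pi)) * indicator ({0..pi} \<times> {0..2 * pi}) (a, b)"
  have [measurable]: "?d \<in> borel_measurable (lborel \<Otimes>\<^sub>M lborel)"
    by measurable
  have "(\<integral>\<^sup>+p. ?d p \<partial>lborel) = (\<integral>\<^sup>+a. \<integral>\<^sup>+b. ?d (a, b) \<partial>lborel \<partial>lborel)"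
    unfolding lborel_prod[symmetric] by (rule lborel.nn_integral_fst[symmetric]) measurable
  also have "\<dots> = (\<integral>\<^sup>+a. \<integral>\<^sup>+b. (ennreal (sin a / (4 * pi)) * indicator {0..pi} a) * indicator {0..2 * pi} b \<partial>lborel \<partial>lborel)"
    by (intro nn_integral_cong) (auto simp: indicator_def)
  also have "\<dots> = (\<integral>\<^sup>+a. ennreal (sin a / 2) * indicator {0..pi} a \<partial>lborel)"
  proof (intro nn_integral_cong)
    fix a :: real
    have "ennreal (sin a / (4 * pi)) * ennreal (2 * pi) = ennreal (sin a / 2)" if "a \<in> {0..pi}"
      using that by (subst ennreal_mult[symmetric]) (auto simp: sin_ge_zero)
    then show "(\<integral>\<^sup>+b. (ennreal (sin a / (4 * pi)) * indicator {0..pi} a) * indicator {0..2 * pi} b \<partial>lborel)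
        = ennreal (sin a / 2) * indicator {0..pi} a"
      by (subst nn_integral_cmult_indicator) (auto simp: indicator_def)
  qed
  also have "\<dots> = ennreal (- cos pi / 2 - (- cos 0 / 2))"
    by (rule nn_integral_FTC_Icc) (auto intro!: derivative_eq_intros simp: sin_ge_zero)
  also have "\<dots> = 1" by simp
  finally have total: "(\<integral>\<^sup>+p. ?d p \<partial>lborel) = 1" .
  have "?d \<in> borel_measurable lborel"
    using \<open>?d \<in> borel_measurable (lborel \<Otimes>\<^sub>M lborel)\<close> by (simp only: lborel_prod)
  then have "prob_space (density lborel ?d)"
    using total by (intro prob_spaceI) (simp add: emeasure_density)
  then show ?thesis
    unfolding unit_sphere_measure_def by (rule prob_space.prob_space_distr) simp
qed

text \<open>
  The tangent line of the convex power function at \<open>m\<close>, arranged so that all terms are nonnegative.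
\<close>

lemma powr_ge_tangent:
  fixes m r y :: real
  assumes r: "r \<ge> 1" and m: "m > 0" and y: "y \<ge> 0"
  shows "r * m powr (r - 1) * y \<le> y powr r + (r - 1) * m powr r"
proof -
  have "y powr r - m powr r \<ge> (r * m powr (r - 1)) * (y - m)"
  proof (rule convex_on_imp_above_tangent[OF convex_on_powr_nonneg[OF r]])
    show "((\<lambda>x. x powr r) has_field_derivative r * m powr (r - 1)) (at m within {0..})"
      using m by (auto intro!: derivative_eq_intros)
  qed (use m y in auto)
  moreover have "m * (r * m powr (r - 1)) = r * m powr r" using m by (simp add: powr_diff)
  ultimately show ?thesis by (simp add: algebra_simps)
qed

lemma measurable_increment_moment [measurable]:
  assumes [measurable]: "f \<in> borel_measurable borel"
  shows "(\<lambda>s. increment_moment p (l *\<^sub>R s) f) \<in> borel_measurable borel"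
proof -
  interpret prob_space torus by (rule prob_space_torus)
  show ?thesis unfolding increment_moment_def by measurable
qed

lemma structure_function_scaled_le:
  assumes [measurable]: "f \<in> borel_measurable borel" and "\<alpha> \<ge> 0" "\<beta> \<ge> 0"
    and le: "\<And>t. t \<ge> 0 \<Longrightarrow> \<alpha> * t powr a \<le> t powr b + \<beta>"
  shows "ennreal \<alpha> * structure_function a l f \<le> structure_function b l f + ennreal \<beta>"
proof -
  interpret T: prob_space torus by (rule prob_space_torus)
  interpret S: prob_space unit_sphere_measure by (rule prob_space_unit_sphere_measure)
  have "ennreal \<alpha> * increment_moment a h f \<le> increment_moment b h f + ennreal \<beta>" for h
  proof -
    have "ennreal \<alpha> * increment_moment a h f = (\<integral>\<^sup>+x. ennreal \<alpha> * ennreal (norm (f (x + h) - f x) powr a) \<partial>torus)"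
      unfolding increment_moment_def by (rule nn_integral_cmult[symmetric]) measurable
    also have "\<dots> \<le> (\<integral>\<^sup>+x. ennreal (norm (f (x + h) - f x) powr b) + ennreal \<beta> \<partial>torus)"
      using assms le by (intro nn_integral_mono)
        (simp add: ennreal_mult'[symmetric] ennreal_plus[symmetric] ennreal_leI del: ennreal_plus)
    also have "\<dots> = increment_moment b h f + ennreal \<beta>"
      by (subst nn_integral_add) (auto simp: increment_moment_def T.emeasure_space_1[simplified])
    finally show ?thesis .
  qed
  then have "(\<integral>\<^sup>+s. ennreal \<alpha> * increment_moment a (l *\<^sub>R s) f \<partial>unit_sphere_measure)
      \<le> (\<integral>\<^sup>+s. increment_moment b (l *\<^sub>R s) f + ennreal \<beta> \<partial>unit_sphere_measure)"
    by (intro nn_integral_mono)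
  then show ?thesis
    by (simp add: structure_function_def nn_integral_cmult nn_integral_add S.emeasure_space_1[simplified])
qed

text \<open>
  Jensen's inequality for the two nested probability averages at once: the pointwise tangent inequality at
  \<open>m\<close> survives both integrations, and at the mean value \<open>m\<close> it is an equality.
\<close>

lemma structure_function_power_mean:
  assumes f: "f \<in> borel_measurable borel" and ab: "0 < a" "a \<le> b"
    and m: "structure_function a l f = ennreal m" "m > 0"
  shows "ennreal (m powr (b / a)) \<le> structure_function b l f"
proof -
  define r where "r = b / a"
  have r: "r \<ge> 1" using ab by (simp add: r_def)
  have "r * m powr (r - 1) * t powr a \<le> t powr b + (r - 1) * m powr r" if "t \<ge> 0" for t
    using powr_ge_tangent[OF r m(2), of "t powr a"] ab by (simp add: powr_powr r_def)
  from structure_function_scaled_le[OF f _ _ this, of l]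
  have "ennreal (r * m powr (r - 1)) * ennreal m \<le> structure_function b l f + ennreal ((r - 1) * m powr r)"
    using r m by simp
  moreover have "ennreal (r * m powr (r - 1)) * ennreal m = ennreal (m powr r) + ennreal ((r - 1) * m powr r)"
    using r m by (simp add: ennreal_mult'[symmetric] ennreal_plus[symmetric] powr_diff algebra_simps del: ennreal_plus)
  ultimately show ?thesis
    by (simp add: r_def add.commute[of _ "ennreal (_ * _)"] ennreal_add_left_cancel_le)
qed

text \<open>
  Both inequalities for the expectation of the logarithm: the lower one is monotonicity, the upper one is Jensen's
  inequality, obtained from the tangent \<open>ln y \<le> ln K + y / K - 1\<close> at \<open>K\<close>.
\<close>

lemma (in prob_space) expectation_ln_bounds:
  assumes [measurable]: "Y \<in> borel_measurable M"
    and L: "L > 0" "\<And>\<omega>. \<omega> \<in> space M \<Longrightarrow> ennreal L \<le> Y \<omega>"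
    and K: "K > 0" "(\<integral>\<^sup>+\<omega>. Y \<omega> \<partial>M) \<le> ennreal K"
  shows "integrable M (\<lambda>\<omega>. ln (enn2real (Y \<omega>)))"
    and "AE \<omega> in M. Y \<omega> = ennreal (enn2real (Y \<omega>)) \<and> L \<le> enn2real (Y \<omega>)"
    and "ln L \<le> expectation (\<lambda>\<omega>. ln (enn2real (Y \<omega>)))"
    and "expectation (\<lambda>\<omega>. ln (enn2real (Y \<omega>))) \<le> ln K"
proof -
  have "(\<integral>\<^sup>+\<omega>. Y \<omega> \<partial>M) \<noteq> \<infinity>" using K(2) by (auto simp: top_unique)
  then have fin: "AE \<omega> in M. Y \<omega> \<noteq> \<infinity>" by (intro nn_integral_PInf_AE) auto
  show ae: "AE \<omega> in M. Y \<omega> = ennreal (enn2real (Y \<omega>)) \<and> L \<le> enn2real (Y \<omega>)"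
    using fin AE_space
  proof eventually_elim
    case (elim \<omega>)
    then have eq: "Y \<omega> = ennreal (enn2real (Y \<omega>))" by (simp add: less_top)
    then show ?case using L(2)[OF elim(2)] by (metis enn2real_nonneg ennreal_le_iff)
  qed
  define y where "y \<omega> = enn2real (Y \<omega>)" for \<omega>
  have [measurable]: "y \<in> borel_measurable M" by (simp add: y_def[abs_def])
  have y: "AE \<omega> in M. Y \<omega> = ennreal (y \<omega>) \<and> L \<le> y \<omega>" using ae by (simp add: y_def)
  have int_Y: "(\<integral>\<^sup>+\<omega>. ennreal (y \<omega>) \<partial>M) = (\<integral>\<^sup>+\<omega>. Y \<omega> \<partial>M)"
    using y by (intro nn_integral_cong_AE) (auto elim: eventually_mono)
  have y_nonneg: "y \<omega> \<ge> 0" for \<omega> by (simp add: y_def)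
  have int_y: "integrable M y"
    by (rule integrableI_nonneg)
       (use K(2) in \<open>auto simp: int_Y y_nonneg intro: le_less_trans\<close>)
  have E_y: "expectation y \<le> K"
    using K int_y y_nonneg
    by (subst (asm) int_Y[symmetric]) (simp add: nn_integral_eq_integral)
  have ln_le: "ln (y \<omega>) \<le> ln K + y \<omega> / K - 1" if "L \<le> y \<omega>" for \<omega>
  proof -
    have "ln (y \<omega> / K) \<le> y \<omega> / K - 1" using that L K by (intro ln_le_minus_one) auto
    then show ?thesis using that L K by (simp add: ln_div)
  qed
  have int: "integrable M (\<lambda>\<omega>. ln (y \<omega>))"
  proof (rule Bochner_Integration.integrable_bound)
    show "integrable M (\<lambda>\<omega>. \<bar>ln L\<bar> + y \<omega>)" using int_y by simp
    show "AE \<omega> in M. norm (ln (y \<omega>)) \<le> norm (\<bar>ln L\<bar> + y \<omega>)"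
      using y
    proof eventually_elim
      case (elim \<omega>)
      then have "ln L \<le> ln (y \<omega>)" "ln (y \<omega>) \<le> y \<omega>"
        using L ln_le_minus_one[of "y \<omega>"] by auto
      then show ?case using y_nonneg[of \<omega>] by auto
    qed
  qed simp
  then show "integrable M (\<lambda>\<omega>. ln (enn2real (Y \<omega>)))" by (simp add: y_def)
  have "expectation (\<lambda>\<omega>. ln L) \<le> expectation (\<lambda>\<omega>. ln (y \<omega>))"
  proof (rule integral_mono_AE)
    show "AE \<omega> in M. ln L \<le> ln (y \<omega>)" using y by eventually_elim (use L in auto)
  qed (use int in auto)
  then show "ln L \<le> expectation (\<lambda>\<omega>. ln (enn2real (Y \<omega>)))" by (simp add: y_def prob_space)
  have "expectation (\<lambda>\<omega>. ln (y \<omega>)) \<le> expectation (\<lambda>\<omega>. ln K + y \<omega> / K - 1)"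
  proof (rule integral_mono_AE)
    show "AE \<omega> in M. ln (y \<omega>) \<le> ln K + y \<omega> / K - 1" using y by eventually_elim (use ln_le in auto)
  qed (use int int_y in auto)
  also have "\<dots> = ln K + expectation y / K - 1" using int_y by (simp add: prob_space)
  also have "\<dots> \<le> ln K" using E_y K by simp
  finally show "expectation (\<lambda>\<omega>. ln (enn2real (Y \<omega>))) \<le> ln K" by (simp add: y_def)
qed

section \<open>The randomized field\<close>

lemma norm_scalar_mult: "norm (a *s (v :: complex^3)) = norm a * norm v"
  by (simp add: norm_vec_def norm_mult L2_set_right_distrib)

lemma scalar_mult_scaleR: "a *s (r *\<^sub>R v) = r *\<^sub>R (a *s (v :: complex^3))"
  by (simp add: vec_eq_iff)

lemma Z3_plus_minus: "- k \<in> Z3_plus \<longleftrightarrow> k \<noteq> 0 \<and> k \<notin> Z3_plus"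
  by (auto simp: Z3_plus_def vec_eq_iff forall_3)

text \<open>
  A frequency and its opposite carry the same sign, so only the sum over \<open>Z3_plus\<close> is a sum with independent signs.
\<close>

lemma sum_symmetric_signs:
  fixes d :: "int^3 \<Rightarrow> 'v::real_vector"
  assumes F: "finite F" "\<And>k. k \<in> F \<Longrightarrow> - k \<in> F" and d: "d 0 = 0"
    and t: "\<And>k. k \<in> Z3_plus \<Longrightarrow> t (- k) = (t k :: real)"
  shows "(\<Sum>k\<in>F. t k *\<^sub>R d k) = (\<Sum>k\<in>F \<inter> Z3_plus. t k *\<^sub>R (d k + d (- k)))"
proof -
  let ?P = "F \<inter> Z3_plus"
  have minus: "uminus ` ?P = F \<inter> {k. k \<noteq> 0 \<and> k \<notin> Z3_plus}"
  proof
    show "F \<inter> {k. k \<noteq> 0 \<and> k \<notin> Z3_plus} \<subseteq> uminus ` ?P"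
    proof
      fix k assume "k \<in> F \<inter> {k. k \<noteq> 0 \<and> k \<notin> Z3_plus}"
      then have "- k \<in> ?P" using F(2) by (simp add: Z3_plus_minus)
      then show "k \<in> uminus ` ?P" by force
    qed
    show "uminus ` ?P \<subseteq> F \<inter> {k. k \<noteq> 0 \<and> k \<notin> Z3_plus}"
      using F(2) Z3_plus_minus by force
  qed
  have "(\<Sum>k\<in>F. t k *\<^sub>R d k) = (\<Sum>k\<in>?P \<union> uminus ` ?P. t k *\<^sub>R d k)"
    using F(1) d unfolding minus by (intro sum.mono_neutral_right) auto
  also have "\<dots> = (\<Sum>k\<in>?P. t k *\<^sub>R d k) + (\<Sum>k\<in>uminus ` ?P. t k *\<^sub>R d k)"
    using F(1) minus by (intro sum.union_disjoint) auto
  also have "(\<Sum>k\<in>uminus ` ?P. t k *\<^sub>R d k) = (\<Sum>k\<in>?P. t k *\<^sub>R d (- k))"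
    using t by (subst sum.reindex) (auto simp: inj_on_def intro!: sum.cong)
  finally show ?thesis by (simp add: sum.distrib scaleR_add_right)
qed

text \<open>
  Here the factor \<open>2\<close> in \<open>(2 A) powr (p/2)\<close> arises: \<open>d\<^sub>k\<close> and \<open>d\<^sub>-\<^sub>k\<close> may be aligned.
\<close>

lemma sum_norm_pairs_le:
  fixes d :: "int^3 \<Rightarrow> 'v::real_normed_vector"
  assumes F: "finite F" "\<And>k. k \<in> F \<Longrightarrow> - k \<in> F" and d: "d 0 = 0"
  shows "(\<Sum>k\<in>F \<inter> Z3_plus. (norm (d k + d (- k)))\<^sup>2) \<le> 2 * (\<Sum>k\<in>F. (norm (d k))\<^sup>2)"
proof -
  have "(norm (d k + d (- k)))\<^sup>2 \<le> 2 * ((norm (d k))\<^sup>2 + (norm (d (- k)))\<^sup>2)" for k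
  proof -
    have "(norm (d k + d (- k)))\<^sup>2 \<le> (norm (d k) + norm (d (- k)))\<^sup>2"
      by (intro power_mono norm_triangle_ineq) auto
    also have "\<dots> \<le> 2 * ((norm (d k))\<^sup>2 + (norm (d (- k)))\<^sup>2)"
      using zero_le_power2[of "norm (d k) - norm (d (- k))"] by (simp add: power2_eq_square algebra_simps)
    finally show ?thesis .
  qed
  then have "(\<Sum>k\<in>F \<inter> Z3_plus. (norm (d k + d (- k)))\<^sup>2)
      \<le> (\<Sum>k\<in>F \<inter> Z3_plus. 2 * ((norm (d k))\<^sup>2 + (norm (d (- k)))\<^sup>2))"
    by (intro sum_mono)
  also have "\<dots> = 2 * (\<Sum>k\<in>F. (norm (d k))\<^sup>2)"
    using sum_symmetric_signs[OF F, of "\<lambda>k. (norm (d k))\<^sup>2" "\<lambda>_. 1"] d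
    by (simp add: sum_distrib_left distrib_left)
  finally show ?thesis .
qed

lemma increment_moment_2: "increment_moment 2 h f = L2_sq (\<lambda>x. f (x + h) - f x)"
  by (simp add: increment_moment_def L2_sq_def powr_numeral)

text \<open>
  Two representatives that agree almost everywhere also do so after a shift, by translation invariance.
\<close>

lemma increment_moment_cong_AE:
  assumes [measurable]: "f \<in> borel_measurable borel" "g \<in> borel_measurable borel"
    and per: "\<And>k x. f (x + lattice_point k) = f x" "\<And>k x. g (x + lattice_point k) = g x"
    and ae: "AE x in torus. f x = g x"
  shows "increment_moment p h f = increment_moment p h g"
proof -
  have "AE x in torus. f (x + h) = g (x + h)"
    by (rule AE_torus_shift[where P = "\<lambda>x. f x = g x"]) (use per ae in auto)
  with ae show ?thesis
    unfolding increment_moment_def by (intro nn_integral_cong_AE) (auto elim: eventually_elim2)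
qed

locale randomized_field = prob_space M
  for M :: "'a measure" +
  fixes \<theta> :: "int^3 \<Rightarrow> 'a \<Rightarrow> real" and c :: "int^3 \<Rightarrow> complex^3"
    and u0 :: "real^3 \<Rightarrow> complex^3" and u :: "'a \<Rightarrow> real^3 \<Rightarrow> complex^3"
  assumes signs: "random_signs M \<theta>"
    and c_0: "c 0 = 0"
    and base: "L2_fourier_sum c u0"
    and field: "\<And>\<omega>. \<omega> \<in> space M \<Longrightarrow> L2_fourier_sum (\<lambda>k. \<theta> k \<omega> *\<^sub>R c k) (u \<omega>)"
begin

lemma fair_sign_theta: "k \<in> Z3_plus \<Longrightarrow> fair_sign M (\<theta> k)"
  using signs by (auto simp: random_signs_def fair_sign_def)

lemma indep_theta: "indep_vars (\<lambda>_. borel) \<theta> Z3_plus"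
  using signs by (simp add: random_signs_def)

lemma theta_minus: "k \<in> Z3_plus \<Longrightarrow> \<omega> \<in> space M \<Longrightarrow> \<theta> (- k) \<omega> = \<theta> k \<omega>"
  using signs by (simp add: random_signs_def)

lemma measurable_theta:
  assumes "k \<noteq> 0"
  shows "\<theta> k \<in> borel_measurable M"
proof -
  have plus: "\<theta> k \<in> borel_measurable M" if "k \<in> Z3_plus" for k
    using indep_theta that by (auto simp: indep_vars_def)
  show ?thesis
  proof (cases "k \<in> Z3_plus")
    case False
    then have "- k \<in> Z3_plus" using assms by (simp add: Z3_plus_minus)
    then show ?thesis
      using plus[of "- k"] theta_minus[of "- k"] by (auto cong: measurable_cong)
  qed (rule plus)
qed

lemma norm_theta_c:
  assumes "\<omega> \<in> space M"
  shows "norm (\<theta> k \<omega> *\<^sub>R c k) = norm (c k)"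
proof (cases "k = 0")
  case False
  have plus: "\<bar>\<theta> k \<omega>\<bar> = 1" if "k \<in> Z3_plus" for k
    using fair_sign_theta[OF that] assms by (auto simp: fair_sign_def)
  have "\<bar>\<theta> k \<omega>\<bar> = 1"
    using plus[of k] plus[of "- k"] theta_minus[of "- k"] assms False Z3_plus_minus[of k] by fastforce
  then show ?thesis by simp
qed (simp add: c_0)

text \<open>
  Parseval's sum for an increment only sees the absolute values of the coefficients.
\<close>

lemma increment_moment_2_randomized:
  assumes \<omega>: "\<omega> \<in> space M"
  shows "increment_moment 2 h (u \<omega>) = increment_moment 2 h u0"
proof -
  have "((\<lambda>k. ennreal ((norm ((wave k h - 1) *s c k))\<^sup>2)) has_sum increment_moment 2 h u0) UNIV"
    unfolding increment_moment_2 by (rule parseval[OF L2_fourier_sum_increment[OF base]])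
  moreover have "((\<lambda>k. ennreal ((norm ((wave k h - 1) *s c k))\<^sup>2)) has_sum increment_moment 2 h (u \<omega>)) UNIV"
    unfolding increment_moment_2
    using parseval[OF L2_fourier_sum_increment[OF field[OF \<omega>]], of h]
    by (simp only: norm_scalar_mult norm_theta_c[OF \<omega>])
  ultimately show ?thesis by (rule has_sum_unique[symmetric])
qed

definition partial_field :: "(int^3) set \<Rightarrow> 'a \<Rightarrow> real^3 \<Rightarrow> complex^3" where
  "partial_field F \<omega> x = (\<Sum>k\<in>F. wave k x *s (\<theta> k \<omega> *\<^sub>R c k))"

definition tail :: "(int^3) set \<Rightarrow> ennreal" where
  "tail F = L2_sq (\<lambda>x. u0 x - (\<Sum>k\<in>F. wave k x *s c k))"

lemma L2_sq_partial_field_error: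
  assumes \<omega>: "\<omega> \<in> space M" and F: "finite F"
  shows "L2_sq (\<lambda>x. u \<omega> x - partial_field F \<omega> x) = tail F"
proof -
  have "((\<lambda>k. ennreal ((norm (if k \<in> F then 0 else \<theta> k \<omega> *\<^sub>R c k))\<^sup>2)) has_sum
      L2_sq (\<lambda>x. u \<omega> x - partial_field F \<omega> x)) UNIV"
    unfolding partial_field_def by (rule parseval[OF L2_fourier_sum_tail[OF field[OF \<omega>] F]])
  moreover have "(norm (if k \<in> F then 0 else \<theta> k \<omega> *\<^sub>R c k))\<^sup>2 = (norm (if k \<in> F then 0 else c k))\<^sup>2" for k
    using norm_theta_c[OF \<omega>, of k] by simp
  ultimately show ?thesis
    using parseval[OF L2_fourier_sum_tail[OF base F]] unfolding tail_def
    by (metis (no_types, lifting) has_sum_cong has_sum_unique)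
qed

text \<open>
  The errors are summable, which is what yields convergence almost everywhere. The sets are symmetric so that
  frequencies can be paired.
\<close>

lemma obtain_symmetric_frequencies:
  obtains F :: "nat \<Rightarrow> (int^3) set" where
    "\<And>j. finite (F j)" "\<And>j k. k \<in> F j \<Longrightarrow> - k \<in> F j" "\<And>j. tail (F j) \<le> ennreal ((1 / 2) ^ j)"
proof -
  have "\<exists>F. finite F \<and> (\<forall>k\<in>F. - k \<in> F) \<and> tail F \<le> ennreal ((1 / 2) ^ j)" for j :: nat
  proof -
    have "(tail \<longlongrightarrow> 0) (finite_subsets_at_top UNIV)"
      using L2_fourier_sumD(4)[OF base] by (simp add: tail_def[abs_def])
    then have "eventually (\<lambda>F. tail F < ennreal ((1 / 2) ^ j)) (finite_subsets_at_top UNIV)"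
      by (rule order_tendstoD) simp
    then obtain X where X: "finite X" "\<And>Y. finite Y \<Longrightarrow> X \<subseteq> Y \<Longrightarrow> tail Y < ennreal ((1 / 2) ^ j)"
      by (auto simp: eventually_finite_subsets_at_top)
    have "tail (X \<union> uminus ` X) \<le> ennreal ((1 / 2) ^ j)"
      by (rule less_imp_le, rule X(2)) (use X(1) in auto)
    moreover have "finite (X \<union> uminus ` X)" "\<forall>k\<in>X \<union> uminus ` X. - k \<in> X \<union> uminus ` X"
      using X(1) by auto
    ultimately show ?thesis by blast
  qed
  then show thesis using that by metis
qed

lemma measurable_partial_field [measurable]:
  "(\<lambda>(\<omega>, x). partial_field F \<omega> x) \<in> borel_measurable (M \<Otimes>\<^sub>M borel)"
proof -
  have "(\<lambda>z. wave k (snd z) *s (\<theta> k (fst z) *\<^sub>R c k)) \<in> borel_measurable (M \<Otimes>\<^sub>M borel)" for k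
  proof (cases "k = 0")
    case False
    note [measurable] = measurable_theta[OF False]
    show ?thesis unfolding scalar_mult_scaleR by measurable
  qed (simp add: c_0)
  then show ?thesis unfolding partial_field_def case_prod_beta by (intro borel_measurable_sum)
qed

lemma partial_field_periodic: "partial_field F \<omega> (x + lattice_point k) = partial_field F \<omega> x"
  by (simp add: partial_field_def wave_lattice)

text \<open>
  The sum over \<open>j\<close> of the squared errors has a finite integral, hence is finite almost everywhere, and its terms tend
  to zero. The shift \<open>h\<close> is included because increments involve two points.
\<close>

lemma partial_field_LIMSEQ:
  assumes F: "\<And>j. finite (F j)" "\<And>j. tail (F j) \<le> ennreal ((1 / 2) ^ j)" and \<omega>: "\<omega> \<in> space M"
  shows "AE x in torus. (\<lambda>j. partial_field (F j) \<omega> (x + h)) \<longlonglongrightarrow> u \<omega> (x + h)"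
proof -
  note uw = L2_fourier_sumD[OF field[OF \<omega>]]
  note [measurable] = uw(1)
  have pm [measurable]: "partial_field G \<omega> \<in> borel_measurable borel" for G
    using measurable_compose[OF measurable_Pair1'[OF \<omega>] measurable_partial_field[of G]] by simp
  define e where "e j x = ennreal ((norm (u \<omega> x - partial_field (F j) \<omega> x))\<^sup>2)" for j x
  have e_meas [measurable]: "e j \<in> borel_measurable borel" for j by (simp add: e_def[abs_def])
  have "(\<integral>\<^sup>+x. (\<Sum>j. e j x) \<partial>torus) = (\<Sum>j. \<integral>\<^sup>+x. e j x \<partial>torus)"
    by (rule nn_integral_suminf) measurable
  also have "\<dots> = (\<Sum>j. tail (F j))"
    using L2_sq_partial_field_error[OF \<omega> F(1)] by (simp add: e_def L2_sq_def)
  finally have total: "(\<integral>\<^sup>+x. (\<Sum>j. e j x) \<partial>torus) = (\<Sum>j. tail (F j))" .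
  have "(\<Sum>j. tail (F j)) \<le> (\<Sum>j. ennreal ((1 / 2) ^ j))"
    by (rule suminf_le[OF F(2) summableI summableI])
  moreover have "(\<Sum>j. ennreal ((1 / 2) ^ j)) = ennreal (\<Sum>j. (1 / 2) ^ j)"
    by (rule suminf_ennreal2) simp_all
  ultimately have le: "(\<integral>\<^sup>+x. (\<Sum>j. e j x) \<partial>torus) \<le> ennreal (\<Sum>j. (1 / 2) ^ j)"
    unfolding total by metis
  have fin: "AE x in torus. (\<Sum>j. e j x) \<noteq> \<infinity>"
  proof (rule nn_integral_PInf_AE)
    have "(\<lambda>x. \<Sum>j. e j x) \<in> borel_measurable borel"
      by (rule borel_measurable_suminf_order) (rule e_meas)
    then show "(\<lambda>x. \<Sum>j. e j x) \<in> borel_measurable torus"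
      by (simp only: measurable_cong_sets[OF sets_torus refl])
    show "(\<integral>\<^sup>+x. (\<Sum>j. e j x) \<partial>torus) \<noteq> \<infinity>"
      using le_less_trans[OF le ennreal_less_top] by (simp add: less_top)
  qed
  have "e j (x + lattice_point k) = e j x" for j x k
    by (simp add: e_def partial_field_periodic uw(2))
  then have "AE x in torus. (\<Sum>j. e j (x + h)) \<noteq> \<infinity>"
    by (intro AE_torus_shift[where P = "\<lambda>x. (\<Sum>j. e j x) \<noteq> \<infinity>", OF _ _ fin]) simp_all
  then show ?thesis
  proof eventually_elim
    case (elim x)
    have "summable (\<lambda>j. (norm (u \<omega> (x + h) - partial_field (F j) \<omega> (x + h)))\<^sup>2)"
      using elim by (intro summable_suminf_not_top) (auto simp: e_def)
    then have "(\<lambda>j. (norm (u \<omega> (x + h) - partial_field (F j) \<omega> (x + h)))\<^sup>2) \<longlonglongrightarrow> 0"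
      by (rule summable_LIMSEQ_zero)
    then have "(\<lambda>j. sqrt ((norm (u \<omega> (x + h) - partial_field (F j) \<omega> (x + h)))\<^sup>2)) \<longlonglongrightarrow> sqrt 0"
      by (intro tendsto_real_sqrt)
    then have "(\<lambda>j. norm (partial_field (F j) \<omega> (x + h) - u \<omega> (x + h))) \<longlonglongrightarrow> 0"
      by (simp only: real_sqrt_abs abs_norm_cancel real_sqrt_zero norm_minus_commute[of "u \<omega> (x + h)"])
    then show ?case
      by (rule LIM_zero_cancel[OF tendsto_norm_zero_cancel])
  qed
qed

text \<open>
  The map \<open>\<omega> \<mapsto> u \<omega>\<close> comes without joint measurability. The pointwise limit of the partial
  fields is jointly measurable and equals \<open>u \<omega>\<close> almost everywhere for each \<open>\<omega>\<close>, hence has the same structure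
  functions.
\<close>

lemma measurable_structure_function [measurable]:
  "(\<lambda>\<omega>. structure_function p l (u \<omega>)) \<in> borel_measurable M"
proof -
  obtain F where F: "\<And>j. finite (F j)" "\<And>j. tail (F j) \<le> ennreal ((1 / 2) ^ j)"
    using obtain_symmetric_frequencies by metis
  interpret T: prob_space torus by (rule prob_space_torus)
  interpret S: prob_space unit_sphere_measure by (rule prob_space_unit_sphere_measure)
  define g where "g \<omega> x = lim (\<lambda>j. partial_field (F j) \<omega> x)" for \<omega> x
  have g [measurable]: "(\<lambda>(\<omega>, x). g \<omega> x) \<in> borel_measurable (M \<Otimes>\<^sub>M borel)"
    unfolding g_def case_prod_beta
    using measurable_partial_field by (intro borel_measurable_lim_metric) (simp add: case_prod_beta)
  have "structure_function p l (u \<omega>) = structure_function p l (g \<omega>)" if \<omega>: "\<omega> \<in> space M" for \<omega>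
  proof -
    note uw = L2_fourier_sumD[OF field[OF \<omega>]]
    have "AE x in torus. u \<omega> x = g \<omega> x"
      using partial_field_LIMSEQ[OF F \<omega>, of 0] by eventually_elim (simp add: g_def limI)
    moreover have "g \<omega> \<in> borel_measurable borel"
      using measurable_compose[OF measurable_Pair1'[OF \<omega>] g] by simp
    moreover have "g \<omega> (x + lattice_point k) = g \<omega> x" for x k
      by (simp add: g_def partial_field_periodic)
    ultimately have "increment_moment p h (u \<omega>) = increment_moment p h (g \<omega>)" for h
      using uw(1,2) by (intro increment_moment_cong_AE)
    then show ?thesis by (simp add: structure_function_def)
  qed
  moreover have "(\<lambda>\<omega>. structure_function p l (g \<omega>)) \<in> borel_measurable M"
    unfolding structure_function_def increment_moment_def by measurable
  ultimately show ?thesis by (simp cong: measurable_cong)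
qed

text \<open>
  The bound holds at every point \<open>x\<close>: in \<open>d\<^sub>k\<close> the point only enters through a factor of modulus \<open>1\<close>, and
  by Parseval the squared norms of the \<open>d\<^sub>k\<close> add up to at most \<open>A\<close>.
\<close>

lemma khintchine_partial_increment:
  assumes F: "finite F" "\<And>k. k \<in> F \<Longrightarrow> - k \<in> F" and p: "p \<ge> 3"
    and A: "increment_moment 2 h u0 = ennreal A" "A \<ge> 0"
  shows "(\<integral>\<^sup>+\<omega>. ennreal (norm (partial_field F \<omega> (x + h) - partial_field F \<omega> x) powr p) \<partial>M)
           \<le> ennreal (khintchine_const p * (2 * A) powr (p / 2))"
proof -
  define d where "d k = wave k x *s ((wave k h - 1) *s c k)" for k
  have d0: "d 0 = 0" by (simp add: d_def)
  have eq: "partial_field F \<omega> (x + h) - partial_field F \<omega> x = (\<Sum>k\<in>F \<inter> Z3_plus. \<theta> k \<omega> *\<^sub>R (d k + d (- k)))"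
    if \<omega>: "\<omega> \<in> space M" for \<omega>
  proof -
    have "partial_field F \<omega> (x + h) - partial_field F \<omega> x = (\<Sum>k\<in>F. \<theta> k \<omega> *\<^sub>R d k)"
      unfolding partial_field_def sum_subtractf[symmetric]
      by (intro sum.cong refl) (simp add: d_def wave_add vec_eq_iff algebra_simps)
    also have "\<dots> = (\<Sum>k\<in>F \<inter> Z3_plus. \<theta> k \<omega> *\<^sub>R (d k + d (- k)))"
      by (rule sum_symmetric_signs[where d = d and t = "\<lambda>k. \<theta> k \<omega>", OF F d0]) (use \<omega> theta_minus in auto)
    finally show ?thesis .
  qed
  have "(\<Sum>k\<in>F. (norm (d k))\<^sup>2) \<le> A"
  proof -
    have "((\<lambda>k. ennreal ((norm ((wave k h - 1) *s c k))\<^sup>2)) has_sum ennreal A) UNIV"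
      using parseval[OF L2_fourier_sum_increment[OF base], of h] by (simp add: increment_moment_2[symmetric] A)
    then have "(\<Sum>k\<in>F. ennreal ((norm ((wave k h - 1) *s c k))\<^sup>2)) \<le> ennreal A"
      by (rule has_sum_mono_neutral[OF has_sum_finite[OF F(1)]]) auto
    then have "ennreal (\<Sum>k\<in>F. (norm ((wave k h - 1) *s c k))\<^sup>2) \<le> ennreal A"
      by (subst (asm) sum_ennreal) auto
    moreover have "norm (d k) = norm ((wave k h - 1) *s c k)" for k
      by (simp only: d_def norm_scalar_mult norm_wave mult_1)
    ultimately show ?thesis by (simp only: ennreal_le_iff[OF A(2)])
  qed
  then have pairs: "(\<Sum>k\<in>F \<inter> Z3_plus. (norm (d k + d (- k)))\<^sup>2) \<le> 2 * A"
    using sum_norm_pairs_le[where d = d, OF F d0] by simp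
  have "(\<integral>\<^sup>+\<omega>. ennreal (norm (partial_field F \<omega> (x + h) - partial_field F \<omega> x) powr p) \<partial>M)
      = (\<integral>\<^sup>+\<omega>. ennreal (norm (\<Sum>k\<in>F \<inter> Z3_plus. \<theta> k \<omega> *\<^sub>R (d k + d (- k))) powr p) \<partial>M)"
    by (intro nn_integral_cong) (simp add: eq)
  also have "\<dots> \<le> ennreal (khintchine_const p * (\<Sum>k\<in>F \<inter> Z3_plus. (norm (d k + d (- k)))\<^sup>2) powr (p / 2))"
    by (rule khintchine_euclidean[OF p])
       (use F(1) indep_vars_subset[OF indep_theta] fair_sign_theta in auto)
  also have "\<dots> \<le> ennreal (khintchine_const p * (2 * A) powr (p / 2))"
    using pairs p khintchine_const_pos[of p]
    by (intro ennreal_leI mult_left_mono powr_mono2) (auto simp: sum_nonneg)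
  finally show ?thesis .
qed

text \<open>
  Fatou's lemma is applied three times, for the averages over the torus, over the sphere and over \<open>\<omega>\<close>. For the partial
  fields, Tonelli's theorem moves the expectation inside, where \<open>khintchine_partial_increment\<close> applies.
\<close>

lemma nn_integral_structure_function_le:
  assumes p: "p \<ge> 3" and l: "l > 0" and A: "A \<ge> 0" "\<And>h. norm h = l \<Longrightarrow> increment_moment 2 h u0 = ennreal A"
  shows "(\<integral>\<^sup>+\<omega>. structure_function p l (u \<omega>) \<partial>M) \<le> ennreal (khintchine_const p * (2 * A) powr (p / 2))"
    (is "_ \<le> ?K")
proof -
  obtain F where F: "\<And>j. finite (F j)" "\<And>j k. k \<in> F j \<Longrightarrow> - k \<in> F j" "\<And>j. tail (F j) \<le> ennreal ((1 / 2) ^ j)"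
    using obtain_symmetric_frequencies by metis
  interpret T: prob_space torus by (rule prob_space_torus)
  interpret S: prob_space unit_sphere_measure by (rule prob_space_unit_sphere_measure)
  interpret MT: pair_sigma_finite M torus ..
  interpret MS: pair_sigma_finite M unit_sphere_measure ..
  let ?P = "\<lambda>j. partial_field (F j)"
  have inc: "increment_moment p h (u \<omega>) \<le> liminf (\<lambda>j. increment_moment p h (?P j \<omega>))" if \<omega>: "\<omega> \<in> space M" for \<omega> h
  proof -
    have pm [measurable]: "?P j \<omega> \<in> borel_measurable borel" for j
      using measurable_compose[OF measurable_Pair1'[OF \<omega>] measurable_partial_field] by simp
    have "increment_moment p h (u \<omega>) = (\<integral>\<^sup>+x. liminf (\<lambda>j. ennreal (norm (?P j \<omega> (x + h) - ?P j \<omega> x) powr p)) \<partial>torus)"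
      unfolding increment_moment_def
    proof (rule nn_integral_cong_AE)
      show "AE x in torus. ennreal (norm (u \<omega> (x + h) - u \<omega> x) powr p)
          = liminf (\<lambda>j. ennreal (norm (?P j \<omega> (x + h) - ?P j \<omega> x) powr p))"
        using partial_field_LIMSEQ[OF F(1,3) \<omega>, of h] partial_field_LIMSEQ[OF F(1,3) \<omega>, of 0]
      proof eventually_elim
        case (elim x)
        have "(\<lambda>j. ennreal (norm (?P j \<omega> (x + h) - ?P j \<omega> x) powr p)) \<longlonglongrightarrow> ennreal (norm (u \<omega> (x + h) - u \<omega> x) powr p)"
          using elim p by (intro tendsto_ennrealI tendsto_powr' tendsto_norm tendsto_diff tendsto_const) auto
        then show ?case by (rule lim_imp_Liminf[OF trivial_limit_sequentially, symmetric])
      qed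
    qed
    also have "\<dots> \<le> liminf (\<lambda>j. increment_moment p h (?P j \<omega>))"
      unfolding increment_moment_def by (rule nn_integral_liminf) measurable
    finally show ?thesis .
  qed
  have meas_inc [measurable]: "(\<lambda>(\<omega>, s). increment_moment p (l *\<^sub>R s) (?P j \<omega>)) \<in> borel_measurable (M \<Otimes>\<^sub>M borel)" for j
    unfolding increment_moment_def by measurable
  have meas_inc': "(\<lambda>(\<omega>, s). increment_moment p (l *\<^sub>R s) (?P j \<omega>))
      \<in> borel_measurable (M \<Otimes>\<^sub>M unit_sphere_measure)" for j
    using meas_inc measurable_cong_sets[OF sets_pair_measure_cong[OF refl sets_unit_sphere_measure] refl] by blast
  have "structure_function p l (u \<omega>) \<le> liminf (\<lambda>j. structure_function p l (?P j \<omega>))" if \<omega>: "\<omega> \<in> space M" for \<omega>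
  proof -
    have [measurable]: "(\<lambda>s. increment_moment p (l *\<^sub>R s) (?P j \<omega>)) \<in> borel_measurable borel" for j
      using measurable_compose[OF measurable_Pair1'[OF \<omega>] meas_inc] by simp
    have "structure_function p l (u \<omega>)
        \<le> (\<integral>\<^sup>+s. liminf (\<lambda>j. increment_moment p (l *\<^sub>R s) (?P j \<omega>)) \<partial>unit_sphere_measure)"
      unfolding structure_function_def by (intro nn_integral_mono inc \<omega>)
    also have "\<dots> \<le> liminf (\<lambda>j. structure_function p l (?P j \<omega>))"
      unfolding structure_function_def by (rule nn_integral_liminf) measurable
    finally show ?thesis .
  qed
  then have "(\<integral>\<^sup>+\<omega>. structure_function p l (u \<omega>) \<partial>M) \<le> (\<integral>\<^sup>+\<omega>. liminf (\<lambda>j. structure_function p l (?P j \<omega>)) \<partial>M)"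
    by (rule nn_integral_mono)
  also have "\<dots> \<le> liminf (\<lambda>j. \<integral>\<^sup>+\<omega>. structure_function p l (?P j \<omega>) \<partial>M)"
    unfolding structure_function_def by (rule nn_integral_liminf) measurable
  also have "\<dots> \<le> liminf (\<lambda>j :: nat. ?K)"
  proof (intro Liminf_mono always_eventually allI)
    fix j
    have "(\<integral>\<^sup>+\<omega>. structure_function p l (?P j \<omega>) \<partial>M)
        = (\<integral>\<^sup>+s. \<integral>\<^sup>+\<omega>. increment_moment p (l *\<^sub>R s) (?P j \<omega>) \<partial>M \<partial>unit_sphere_measure)"
      unfolding structure_function_def by (rule MS.Fubini'[symmetric]) (rule meas_inc')
    also have "\<dots> = (\<integral>\<^sup>+s. \<integral>\<^sup>+x. \<integral>\<^sup>+\<omega>. ennreal (norm (?P j \<omega> (x + l *\<^sub>R s) - ?P j \<omega> x) powr p) \<partial>M \<partial>torus \<partial>unit_sphere_measure)"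
      unfolding increment_moment_def by (rule nn_integral_cong, rule MT.Fubini'[symmetric]) measurable
    also have "\<dots> \<le> (\<integral>\<^sup>+s. \<integral>\<^sup>+x. ?K \<partial>torus \<partial>unit_sphere_measure)"
    proof (rule nn_integral_mono_AE, use AE_unit_sphere in eventually_elim)
      fix s :: "real^3" assume "norm s = 1"
      then have "norm (l *\<^sub>R s) = l" using l by simp
      then show "(\<integral>\<^sup>+x. \<integral>\<^sup>+\<omega>. ennreal (norm (?P j \<omega> (x + l *\<^sub>R s) - ?P j \<omega> x) powr p) \<partial>M \<partial>torus) \<le> (\<integral>\<^sup>+x. ?K \<partial>torus)"
        by (intro nn_integral_mono khintchine_partial_increment[OF F(1) F(2) p] A)
    qed
    also have "\<dots> = ?K"
      by (simp add: T.emeasure_space_1[simplified] S.emeasure_space_1[simplified])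
    finally show "(\<integral>\<^sup>+\<omega>. structure_function p l (?P j \<omega>) \<partial>M) \<le> ?K" .
  qed
  also have "\<dots> = ?K" by (simp add: Liminf_const)
  finally show ?thesis .
qed

end

section \<open>Bounds for the expected exponent\<close>

lemma structure_function_isotropic:
  assumes iso: "isotropic_at l f" and l: "l > 0" and h: "norm h = l"
  shows "structure_function 2 l f = increment_moment 2 h f"
proof -
  interpret S: prob_space unit_sphere_measure by (rule prob_space_unit_sphere_measure)
  have "structure_function 2 l f = (\<integral>\<^sup>+s. increment_moment 2 h f \<partial>unit_sphere_measure)"
    unfolding structure_function_def
  proof (rule nn_integral_cong_AE, use AE_unit_sphere in eventually_elim)
    fix s :: "real^3" assume "norm s = 1"
    then have "norm (l *\<^sub>R s) = l" using l by simp
    then show "increment_moment 2 (l *\<^sub>R s) f = increment_moment 2 h f"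
      using iso[unfolded isotropic_at_def, rule_format, OF _ _ h, of 2] by simp
  qed
  also have "\<dots> = increment_moment 2 h f" by (simp add: S.emeasure_space_1[simplified])
  finally show ?thesis .
qed

context randomized_field
begin

text \<open>
  Everything is stated for the logarithms \<open>X q\<close> of the structure functions and divided by \<open>ln l < 0\<close> at the
  end. The normalization \<open>E \<zeta>\<^sub>3 = 1\<close> enters as \<open>E (X 3) = ln l\<close>.
\<close>

lemma zeta_bounds:
  assumes p: "p \<ge> 3" and l: "0 < l" "l < 1" and iso: "isotropic_at l u0"
    and nontriv: "structure_function 2 l u0 > 0"
    and zeta3: "expectation (\<lambda>\<omega>. zeta 3 l (u \<omega>)) = 1"
  shows "integrable M (\<lambda>\<omega>. zeta p l (u \<omega>))"
    and "p / 3 + (- ln (sqrt pi) + p * ln 2 + ln (Gamma ((p + 1) / 2))) / ln l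
           \<le> expectation (\<lambda>\<omega>. zeta p l (u \<omega>))"
    and "expectation (\<lambda>\<omega>. zeta p l (u \<omega>)) \<le> p / 3"
proof -
  define A where "A = enn2real (structure_function 2 l u0)"
  have inc: "increment_moment 2 h u0 = ennreal A" if "norm h = l" for h
  proof -
    have "increment_moment 2 h u0 < \<infinity>"
      unfolding increment_moment_2 by (rule L2_fourier_sumD(3)[OF L2_fourier_sum_increment[OF base]])
    then show ?thesis
      unfolding A_def structure_function_isotropic[OF iso l(1) that] by simp
  qed
  obtain h :: "real^3" where h: "norm h = l" using l vector_choose_size[of l] by auto
  have S2: "structure_function 2 l u0 = ennreal A"
    using structure_function_isotropic[OF iso l(1) h] inc[OF h] by simp
  then have A: "A > 0" using nontriv by simp
  define S where "S q \<omega> = structure_function q l (u \<omega>)" for q \<omega>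
  have S_meas [measurable]: "S q \<in> borel_measurable M" for q
    unfolding S_def[abs_def] by (rule measurable_structure_function)
  define K where "K q = khintchine_const q * (2 * A) powr (q / 2)" for q
  have lower: "ennreal (A powr (q / 2)) \<le> S q \<omega>" if q: "q \<ge> 3" and \<omega>: "\<omega> \<in> space M" for q \<omega>
  proof -
    have "structure_function 2 l (u \<omega>) = ennreal A"
      unfolding S2[symmetric] structure_function_def by (simp only: increment_moment_2_randomized[OF \<omega>])
    then show ?thesis
      unfolding S_def using q A
      by (intro structure_function_power_mean[OF L2_fourier_sumD(1)[OF field[OF \<omega>]]]) auto
  qed
  have upper: "(\<integral>\<^sup>+\<omega>. S q \<omega> \<partial>M) \<le> ennreal (K q)" if "q \<ge> 3" for q
    unfolding S_def K_def using that A by (intro nn_integral_structure_function_le inc l) auto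
  define X where "X q \<omega> = ln (enn2real (S q \<omega>))" for q \<omega>
  have pos: "A powr (q / 2) > 0" "K q > 0" if "q \<ge> 3" for q
    using A that khintchine_const_pos[of q] by (auto simp: K_def)
  have ln_bounds: "integrable M (X q)"
      "AE \<omega> in M. S q \<omega> = ennreal (enn2real (S q \<omega>)) \<and> A powr (q / 2) \<le> enn2real (S q \<omega>)"
      "ln (A powr (q / 2)) \<le> expectation (X q)" "expectation (X q) \<le> ln (K q)"
    if q: "q \<ge> 3" for q
    using expectation_ln_bounds[OF S_meas pos(1)[OF q] lower[OF q] pos(2)[OF q] upper[OF q]]
    unfolding X_def[abs_def] by blast+
  have zeta: "zeta q l (u \<omega>) = X q \<omega> / ln l" for q \<omega>
    by (simp add: zeta_def log_def X_def S_def)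
  have ln_l: "ln l < 0" using l by simp
  have E_zeta: "expectation (\<lambda>\<omega>. zeta q l (u \<omega>)) = expectation (X q) / ln l" for q
    by (simp add: zeta)
  show "integrable M (\<lambda>\<omega>. zeta p l (u \<omega>))"
    using ln_bounds(1)[OF p] by (simp add: zeta)
  have X3: "expectation (X 3) = ln l"
    using zeta3 ln_l unfolding E_zeta by (simp add: field_simps)
  \<comment> \<open>The inequality \<open>S\<^sub>3 \<ge> A powr (3/2)\<close>, after logarithms and expectations.\<close>
  have lnA: "3 / 2 * ln A \<le> ln l"
    using ln_bounds(3)[of 3] X3 A by (simp add: ln_powr)
  have "expectation (X p) \<le> ln (K p)"
    by (rule ln_bounds(4)[OF p])
  also have "ln (K p) = ln (khintchine_const p) + p / 2 * (ln 2 + ln A)"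
    using A p khintchine_const_pos[of p] by (simp add: K_def ln_mult ln_powr)
  also have "ln (khintchine_const p) = p / 2 * ln 2 + ln (Gamma ((p + 1) / 2)) - ln (sqrt pi)"
  proof -
    have "Gamma ((p + 1) / 2) > 0" using p by (intro Gamma_real_pos) simp
    then have "Gamma ((p + 1) / 2) \<noteq> 0" by simp
    then show ?thesis by (simp add: khintchine_const_def ln_mult ln_div ln_powr)
  qed
  also have "p / 2 * (ln 2 + ln A) = p / 2 * ln 2 + p / 3 * (3 / 2 * ln A)" by (simp add: distrib_left)
  finally have "expectation (X p) \<le> p / 3 * ln l + (- ln (sqrt pi) + p * ln 2 + ln (Gamma ((p + 1) / 2)))"
    using mult_left_mono[OF lnA, of "p / 3"] p by linarith
  then have "(p / 3 * ln l + (- ln (sqrt pi) + p * ln 2 + ln (Gamma ((p + 1) / 2)))) / ln l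
      \<le> expectation (X p) / ln l"
    by (rule divide_right_mono_neg) (use ln_l in simp)
  then show "p / 3 + (- ln (sqrt pi) + p * ln 2 + ln (Gamma ((p + 1) / 2))) / ln l
      \<le> expectation (\<lambda>\<omega>. zeta p l (u \<omega>))"
    unfolding E_zeta using ln_l by (simp only: add_divide_distrib[of "p / 3 * ln l"]) simp
  have "AE \<omega> in M. p / 3 * X 3 \<omega> \<le> X p \<omega>"
    using ln_bounds(2)[of 3, OF order_refl] ln_bounds(2)[OF p] AE_space
  proof eventually_elim
    case (elim \<omega>)
    have y3: "enn2real (S 3 \<omega>) > 0" and yp: "enn2real (S p \<omega>) > 0"
      using less_le_trans[OF pos(1)[OF order_refl] conjunct2[OF elim(1)]]
        less_le_trans[OF pos(1)[OF p] conjunct2[OF elim(2)]] .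
    have "ennreal (enn2real (S 3 \<omega>) powr (p / 3)) \<le> S p \<omega>"
      unfolding S_def[of p]
    proof (rule structure_function_power_mean[OF L2_fourier_sumD(1)[OF field[OF elim(3)]]])
      show "structure_function 3 l (u \<omega>) = ennreal (enn2real (S 3 \<omega>))"
        unfolding S_def[symmetric] by (rule conjunct1[OF elim(1)])
    qed (use p y3 in simp_all)
    also have "S p \<omega> = ennreal (enn2real (S p \<omega>))" using elim(2) by (rule conjunct1)
    finally have "enn2real (S 3 \<omega>) powr (p / 3) \<le> enn2real (S p \<omega>)"
      by (simp only: ennreal_le_iff[OF less_imp_le[OF yp]])
    then have "ln (enn2real (S 3 \<omega>) powr (p / 3)) \<le> ln (enn2real (S p \<omega>))"
      using y3 by (intro ln_mono) auto
    then show ?case using y3 by (simp add: X_def ln_powr)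
  qed
  then have "expectation (\<lambda>\<omega>. p / 3 * X 3 \<omega>) \<le> expectation (X p)"
    using ln_bounds(1)[of 3] ln_bounds(1)[OF p]
    by (intro integral_mono_AE) simp_all
  then have "p / 3 * ln l \<le> expectation (X p)" by (simp add: X3)
  then show "expectation (\<lambda>\<omega>. zeta p l (u \<omega>)) \<le> p / 3"
    unfolding E_zeta using ln_l by (simp add: field_simps)
qed

end

theorem mainTheorem4:
  fixes M :: "'a measure"
    and \<theta> :: "int^3 \<Rightarrow> 'a \<Rightarrow> real"
    and c :: "int^3 \<Rightarrow> complex^3"
    and u0 :: "real^3 \<Rightarrow> complex^3"
    and u :: "'a \<Rightarrow> real^3 \<Rightarrow> complex^3"
    and p :: real
  assumes "prob_space M"
    and "random_signs M \<theta>"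
    and "\<And>k i. c (- k) $ i = cnj (c k $ i)"
    and "c 0 = 0"
    and "L2_fourier_sum c u0"
    and "\<And>\<omega>. \<omega> \<in> space M \<Longrightarrow> L2_fourier_sum (\<lambda>k. \<theta> k \<omega> *\<^sub>R c k) (u \<omega>)"
    and "p \<ge> 3"
  shows "(\<forall>l. 0 < l \<and> l < 1 \<and> isotropic_at l u0 \<and> structure_function 2 l u0 > 0 \<and>
              prob_space.expectation M (\<lambda>\<omega>. zeta 3 l (u \<omega>)) = 1 \<longrightarrow>
            integrable M (\<lambda>\<omega>. zeta p l (u \<omega>)) \<and>
            p / 3 + (- ln (sqrt pi) + p * ln 2 + ln (Gamma ((p + 1) / 2))) / ln l
              \<le> prob_space.expectation M (\<lambda>\<omega>. zeta p l (u \<omega>)) \<and>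
            prob_space.expectation M (\<lambda>\<omega>. zeta p l (u \<omega>))
              \<le> p * (1 / 3 - 2 * ln 2 / (3 * ln l)))
       \<and> ((\<forall>\<^sub>F l in at_right 0. isotropic_at l u0 \<and> structure_function 2 l u0 > 0 \<and>
              prob_space.expectation M (\<lambda>\<omega>. zeta 3 l (u \<omega>)) = 1) \<longrightarrow>
          ((\<lambda>l. prob_space.expectation M (\<lambda>\<omega>. zeta p l (u \<omega>))) \<longlongrightarrow> p / 3) (at_right 0))"
proof -
  interpret randomized_field M \<theta> c u0 u
    by (rule randomized_field.intro[OF assms(1)], rule randomized_field_axioms.intro)
       (rule assms(2,4,5,6); assumption)+
  let ?E = "\<lambda>l. expectation (\<lambda>\<omega>. zeta p l (u \<omega>))"
  let ?good = "\<lambda>l. isotropic_at l u0 \<and> structure_function 2 l u0 > 0 \<and> expectation (\<lambda>\<omega>. zeta 3 l (u \<omega>)) = 1"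
  let ?C = "- ln (sqrt pi) + p * ln 2 + ln (Gamma ((p + 1) / 2))"
  have bounds: "integrable M (\<lambda>\<omega>. zeta p l (u \<omega>)) \<and> p / 3 + ?C / ln l \<le> ?E l \<and> ?E l \<le> p / 3"
    if l: "0 < l" "l < 1" and good: "?good l" for l
    by (intro conjI zeta_bounds[OF assms(7) l good[THEN conjunct1]
          good[THEN conjunct2, THEN conjunct1] good[THEN conjunct2, THEN conjunct2]])
  have slack: "p / 3 \<le> p * (1 / 3 - 2 * ln 2 / (3 * ln l))" if "0 < l" "l < 1" for l
  proof -
    have "0 \<le> 2 * ln (2::real)" "3 * ln l < 0" using that by simp_all
    then have "2 * ln 2 / (3 * ln l) \<le> 0" by (rule divide_nonneg_neg)
    then have "p * (1 / 3) \<le> p * (1 / 3 - 2 * ln 2 / (3 * ln l))"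
      using assms(7) by (intro mult_left_mono) linarith+
    then show ?thesis by simp
  qed
  show ?thesis
  proof (intro conjI allI impI; (elim conjE)?)
    fix l :: real
    assume l: "0 < l" "l < 1"
      and good: "isotropic_at l u0" "structure_function 2 l u0 > 0" "expectation (\<lambda>\<omega>. zeta 3 l (u \<omega>)) = 1"
    note b = bounds[OF l conjI[OF good(1) conjI[OF good(2,3)]]]
    show "integrable M (\<lambda>\<omega>. zeta p l (u \<omega>))" by (rule conjunct1[OF b])
    show "p / 3 + ?C / ln l \<le> ?E l" by (rule conjunct1[OF conjunct2[OF b]])
    show "?E l \<le> p * (1 / 3 - 2 * ln 2 / (3 * ln l))"
      by (rule order_trans[OF conjunct2[OF conjunct2[OF b]] slack[OF l]])
  next
    assume good: "\<forall>\<^sub>F l in at_right 0. ?good l"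
    have "\<forall>\<^sub>F l in at_right 0. 0 < l \<and> l < (1::real)"
      unfolding eventually_at_right_field by (intro exI[of _ 1]) auto
    with good have ev: "\<forall>\<^sub>F l in at_right 0. p / 3 + ?C / ln l \<le> ?E l \<and> ?E l \<le> p / 3"
    proof eventually_elim
      case (elim l)
      show ?case
        by (rule conjunct2[OF bounds[OF conjunct1[OF elim(2)] conjunct2[OF elim(2)] elim(1)]])
    qed
    have "((\<lambda>l. ?C / ln l) \<longlongrightarrow> 0) (at_right 0)"
      by (rule tendsto_divide_0[OF tendsto_const filterlim_at_bot_imp_at_infinity[OF ln_at_0]])
    from tendsto_add[OF tendsto_const this, of "p / 3"]
    have lim: "((\<lambda>l. p / 3 + ?C / ln l) \<longlongrightarrow> p / 3) (at_right 0)"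
      by (simp only: add_0_right)
    show "(?E \<longlongrightarrow> p / 3) (at_right 0)"
      by (rule tendsto_sandwich[OF eventually_mono[OF ev conjunct1] eventually_mono[OF ev conjunct2] lim tendsto_const])
  qed
qed

end
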